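(* (1) Let $\mathcal S$ be a semitopological semigroup compactification of $\mathbb Z$. Let $\Theta:M(\mathcal S)\to\ell_1(\mathbb Z)$ be a bounded projection which is also a homomorphism with respect to convolution. Define $$F={}^\perp\ker\Theta=\{f\in C(\mathcal S):\langle\Psi,f\rangle=0\text{ for all }\Psi\in\ker\Theta\}.$$ If $\ker\Theta$ is weak$^*$-closed in $M(\mathcal S)=C(\mathcal S)^*$, then $F$, identified (by restriction of functions to $\mathbb Z$) with a subspace of $\ell_\infty(\mathbb Z)$, is a shift-invariant predual of $\ell_1(\mathbb Z)$. (2) Conversely, if $E\subseteq\ell_\infty(\mathbb Z)$ is a shift-invariant predual of $\ell_1(\mathbb Z)$, then there exist a semitopological semigroup compactification $\mathcal S$ of $\mathbb Z$ and a bounded projection $\Theta:M(\mathcal S)\to\ell_1(\mathbb Z)$, which is a homomorphism with respect to convolution, such that $\ker\Theta$ is weak$^*$-closed in $M(\mathcal S)$ and such that $E={}^\perp\ker\Theta$ (identified with a subspace of $\ell_\infty(\mathbb Z)$ by restriction to $\mathbb Z$). Moreover, $\mathcal S$ can be chosen so that the map $\mathcal S\to\ell_1(\mathbb Z)$, $s\mapsto\Theta(\delta_s)$, is injective.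
   Context: Scalars are complex. Write $\langle x,a\rangle=\sum_{n}x(n)a(n)$ for $x\in\ell_\infty(\mathbb Z)$, $a\in\ell_1(\mathbb Z)$. For a closed subspace $F\subseteq\ell_\infty(\mathbb Z)$ let $\iota_F:\ell_1(\mathbb Z)\to F^*$ be $\iota_F(a)(x)=\langle x,a\rangle$. $F$ is a concrete predual of $\ell_1(\mathbb Z)$ if $\iota_F$ is an isomorphism of Banach spaces (not assumed isometric). With $\sigma(x)(n)=x(n-1)$ the bilateral shift on $\ell_\infty(\mathbb Z)$, a shift-invariant predual of $\ell_1(\mathbb Z)$ is a concrete predual $F$ with $\sigma(F)=F$. $\ell_1(\mathbb Z)$ carries the convolution product. A semitopological semigroup is a semigroup $(\mathcal S,+)$ with a topology making addition separately continuous. A semitopological semigroup compactification of $\mathbb Z$ is a compact Hausdorff semitopological semigroup $\mathcal S$ together with an injective semigroup homomorphism $\mathbb Z\to\mathcal S$ with dense range; $\mathbb Z$ is then regarded as a subset of $\mathcal S$ (and $\mathcal S$ is automatically abelian). $M(\mathcal S)=C(\mathcal S)^*$ is the space of (regular) complex Borel measures of bounded variation, $\ell_1(\mathbb Z)$ is regarded as a subspace of $M(\mathcal S)$, and $M(\mathcal S)$ is a commutative Banach algebra under the convolution $\langle\Phi*\Psi,f\rangle=\int\int f(s+t)\,d\Phi(s)\,d\Psi(t)$, $f\in C(\mathcal S)$, extending that of $\ell_1(\mathbb Z)$. A map $\Theta:M(\mathcal S)\to\ell_1(\mathbb Z)$ is a projection if it is linear and $\Theta(a)=a$ for all $a\in\ell_1(\mathbb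 Z)\subseteq M(\mathcal S)$. Since $\mathbb Z$ is dense in $\mathcal S$, restriction to $\mathbb Z$ identifies $C(\mathcal S)$ isometrically with a subspace of $\ell_\infty(\mathbb Z)$. $\delta_s$ is the point mass at $s$. *)

theory Defs
  imports "HOL-Analysis.Analysis"
begin

section \<open>Sup-normed function spaces and their duals\<close>

text \<open>Complex vector spaces are represented by sets of functions into the complex
  numbers with the pointwise operations. This covers $\ell_\infty(Z)$, $\ell_1(Z)$ and $C(S)$,
  and also dual spaces (whose elements are functions on a space of functions).\<close>

definition complex_subspace :: "('i \<Rightarrow> complex) set \<Rightarrow> bool" where
  "complex_subspace V \<longleftrightarrow>
     (\<lambda>_. 0) \<in> V \<and>
     (\<forall>f\<in>V. \<forall>g\<in>V. (\<lambda>i. f i + g i) \<in> V) \<and>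
     (\<forall>c. \<forall>f\<in>V. (\<lambda>i. c * f i) \<in> V)"

definition complex_linear_on ::
  "('i \<Rightarrow> complex) set \<Rightarrow> (('i \<Rightarrow> complex) \<Rightarrow> ('k \<Rightarrow> complex)) \<Rightarrow> bool" where
  "complex_linear_on V T \<longleftrightarrow>
     (\<forall>f\<in>V. \<forall>g\<in>V. T (\<lambda>i. f i + g i) = (\<lambda>k. T f k + T g k)) \<and>
     (\<forall>c. \<forall>f\<in>V. T (\<lambda>i. c * f i) = (\<lambda>k. c * T f k))"

definition sup_norm :: "'i set \<Rightarrow> ('i \<Rightarrow> complex) \<Rightarrow> real" where
  "sup_norm A f = (SUP i\<in>A. norm (f i))"

text \<open>The dual of a space \<open>V\<close> of functions normed by the supremum over \<open>A\<close>. Functionals are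
  set to \<open>0\<close> off \<open>V\<close> so that equality of functionals is equality on \<open>V\<close>.\<close>

definition dual_space ::
  "'i set \<Rightarrow> ('i \<Rightarrow> complex) set \<Rightarrow> (('i \<Rightarrow> complex) \<Rightarrow> complex) set" where
  "dual_space A V = {\<phi>.
     (\<forall>f\<in>V. \<forall>g\<in>V. \<phi> (\<lambda>i. f i + g i) = \<phi> f + \<phi> g) \<and>
     (\<forall>c. \<forall>f\<in>V. \<phi> (\<lambda>i. c * f i) = c * \<phi> f) \<and>
     (\<exists>K. \<forall>f\<in>V. norm (\<phi> f) \<le> K * sup_norm A f) \<and>
     (\<forall>f. f \<notin> V \<longrightarrow> \<phi> f = 0)}"

definition dual_norm ::
  "'i set \<Rightarrow> ('i \<Rightarrow> complex) set \<Rightarrow> (('i \<Rightarrow> complex) \<Rightarrow> complex) \<Rightarrow> real" where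
  "dual_norm A V \<phi> = (SUP f\<in>{f \<in> V. sup_norm A f \<le> 1}. norm (\<phi> f))"

definition weak_star_topology ::
  "'i set \<Rightarrow> ('i \<Rightarrow> complex) set \<Rightarrow> (('i \<Rightarrow> complex) \<Rightarrow> complex) topology" where
  "weak_star_topology A V =
     topology_generated_by {{\<phi> \<in> dual_space A V. \<phi> f \<in> U} | f U. f \<in> V \<and> open U}"


section \<open>Shift-invariant preduals of $\ell_1(Z)$\<close>

definition ell_inf :: "(int \<Rightarrow> complex) set" where
  "ell_inf = {x. bounded (range x)}"

definition ell1 :: "(int \<Rightarrow> complex) set" where
  "ell1 = {a. (\<lambda>n. norm (a n)) summable_on UNIV}"

definition ell1_norm :: "(int \<Rightarrow> complex) \<Rightarrow> real" where
  "ell1_norm a = (\<Sum>\<^sub>\<infinity>n. norm (a n))"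

definition ell1_conv :: "(int \<Rightarrow> complex) \<Rightarrow> (int \<Rightarrow> complex) \<Rightarrow> (int \<Rightarrow> complex)" where
  "ell1_conv a b = (\<lambda>n. \<Sum>\<^sub>\<infinity>k. a k * b (n - k))"

definition shift :: "(int \<Rightarrow> complex) \<Rightarrow> (int \<Rightarrow> complex)" where
  "shift x = (\<lambda>n. x (n - 1))"

text \<open>Norm-closedness in $\ell_\infty(Z)$ is closedness under uniform limits of sequences.\<close>

definition closed_subspace_ell_inf :: "(int \<Rightarrow> complex) set \<Rightarrow> bool" where
  "closed_subspace_ell_inf F \<longleftrightarrow>
     F \<subseteq> ell_inf \<and> complex_subspace F \<and>
     (\<forall>u x. (\<forall>k. u k \<in> F) \<and> uniform_limit UNIV u x sequentially \<longrightarrow> x \<in> F)"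

definition iota ::
  "(int \<Rightarrow> complex) set \<Rightarrow> (int \<Rightarrow> complex) \<Rightarrow> ((int \<Rightarrow> complex) \<Rightarrow> complex)" where
  "iota F a = (\<lambda>x. if x \<in> F then \<Sum>\<^sub>\<infinity>n. x n * a n else 0)"

definition concrete_predual :: "(int \<Rightarrow> complex) set \<Rightarrow> bool" where
  "concrete_predual F \<longleftrightarrow>
     closed_subspace_ell_inf F \<and>
     complex_linear_on ell1 (iota F) \<and>
     bij_betw (iota F) ell1 (dual_space UNIV F) \<and>
     (\<exists>K. \<forall>a\<in>ell1. dual_norm UNIV F (iota F a) \<le> K * ell1_norm a) \<and>
     (\<exists>K. \<forall>a\<in>ell1. ell1_norm a \<le> K * dual_norm UNIV F (iota F a))"

definition shift_invariant_predual :: "(int \<Rightarrow> complex) set \<Rightarrow> bool" where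
  "shift_invariant_predual F \<longleftrightarrow> concrete_predual F \<and> shift ` F = F"


section \<open>Semitopological semigroup compactifications of the integers\<close>

definition semitopological_semigroup :: "'s topology \<Rightarrow> ('s \<Rightarrow> 's \<Rightarrow> 's) \<Rightarrow> bool" where
  "semitopological_semigroup S add \<longleftrightarrow>
     (\<forall>s\<in>topspace S. \<forall>t\<in>topspace S. add s t \<in> topspace S) \<and>
     (\<forall>r\<in>topspace S. \<forall>s\<in>topspace S. \<forall>t\<in>topspace S. add (add r s) t = add r (add s t)) \<and>
     (\<forall>t\<in>topspace S. continuous_map S S (\<lambda>s. add s t)) \<and>
     (\<forall>s\<in>topspace S. continuous_map S S (\<lambda>t. add s t))"

definition semigroup_compactification ::
  "'s topology \<Rightarrow> ('s \<Rightarrow> 's \<Rightarrow> 's) \<Rightarrow> (int \<Rightarrow> 's) \<Rightarrow> bool" where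
  "semigroup_compactification S add j \<longleftrightarrow>
     semitopological_semigroup S add \<and> compact_space S \<and> Hausdorff_space S \<and>
     range j \<subseteq> topspace S \<and> inj j \<and> (\<forall>m n. j (m + n) = add (j m) (j n)) \<and>
     S closure_of range j = topspace S"

text \<open>Values of functions off \<open>topspace S\<close> are left unconstrained. They play no role:
  the norm on $C(S)$ is the supremum over \<open>topspace S\<close>, so bounded functionals
  take the same value on functions that agree on \<open>topspace S\<close>.\<close>

definition cont_funs :: "'s topology \<Rightarrow> ('s \<Rightarrow> complex) set" where
  "cont_funs S = {f. continuous_map S euclidean f}"

text \<open>$M(S)$ is taken to be $C(S)^*$, and \<open>\<Phi> f\<close> is the integral of \<open>f\<close> against \<open>\<Phi>\<close>.\<close>

definition meas :: "'s topology \<Rightarrow> (('s \<Rightarrow> complex) \<Rightarrow> complex) set" where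
  "meas S = dual_space (topspace S) (cont_funs S)"

definition meas_norm :: "'s topology \<Rightarrow> (('s \<Rightarrow> complex) \<Rightarrow> complex) \<Rightarrow> real" where
  "meas_norm S = dual_norm (topspace S) (cont_funs S)"

definition point_mass :: "'s topology \<Rightarrow> 's \<Rightarrow> (('s \<Rightarrow> complex) \<Rightarrow> complex)" where
  "point_mass S s = (\<lambda>f. if f \<in> cont_funs S then f s else 0)"

definition ell1_to_meas ::
  "'s topology \<Rightarrow> (int \<Rightarrow> 's) \<Rightarrow> (int \<Rightarrow> complex) \<Rightarrow> (('s \<Rightarrow> complex) \<Rightarrow> complex)" where
  "ell1_to_meas S j a = (\<lambda>f. if f \<in> cont_funs S then \<Sum>\<^sub>\<infinity>n. a n * f (j n) else 0)"

text \<open>The iterated integral of \<open>f (s + t)\<close>, first in \<open>s\<close> against \<open>\<Phi>\<close>, then in \<open>t\<close> against \<open>\<Psi>\<close>.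
  For \<open>\<Phi>\<close> in $M(S)$ and \<open>S\<close> compact and semitopological, the inner integral is a continuous
  function of \<open>t\<close> (Grothendieck), so \<open>\<Psi>\<close> is only ever applied to members of $C(S)$.\<close>

definition meas_conv ::
  "'s topology \<Rightarrow> ('s \<Rightarrow> 's \<Rightarrow> 's) \<Rightarrow> (('s \<Rightarrow> complex) \<Rightarrow> complex) \<Rightarrow>
   (('s \<Rightarrow> complex) \<Rightarrow> complex) \<Rightarrow> (('s \<Rightarrow> complex) \<Rightarrow> complex)" where
  "meas_conv S add \<Phi> \<Psi> =
     (\<lambda>f. if f \<in> cont_funs S then \<Psi> (\<lambda>t. \<Phi> (\<lambda>s. f (add s t))) else 0)"

definition bounded_projection ::
  "'s topology \<Rightarrow> (int \<Rightarrow> 's) \<Rightarrow> ((('s \<Rightarrow> complex) \<Rightarrow> complex) \<Rightarrow> (int \<Rightarrow> complex)) \<Rightarrow> bool" where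
  "bounded_projection S j \<Theta> \<longleftrightarrow>
     \<Theta> ` meas S \<subseteq> ell1 \<and> complex_linear_on (meas S) \<Theta> \<and>
     (\<exists>K. \<forall>\<Phi>\<in>meas S. ell1_norm (\<Theta> \<Phi>) \<le> K * meas_norm S \<Phi>) \<and>
     (\<forall>a\<in>ell1. \<Theta> (ell1_to_meas S j a) = a)"

definition conv_homomorphism ::
  "'s topology \<Rightarrow> ('s \<Rightarrow> 's \<Rightarrow> 's) \<Rightarrow>
   ((('s \<Rightarrow> complex) \<Rightarrow> complex) \<Rightarrow> (int \<Rightarrow> complex)) \<Rightarrow> bool" where
  "conv_homomorphism S add \<Theta> \<longleftrightarrow>
     (\<forall>\<Phi>\<in>meas S. \<forall>\<Psi>\<in>meas S. \<Theta> (meas_conv S add \<Phi> \<Psi>) = ell1_conv (\<Theta> \<Phi>) (\<Theta> \<Psi>))"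

definition meas_ker ::
  "'s topology \<Rightarrow> ((('s \<Rightarrow> complex) \<Rightarrow> complex) \<Rightarrow> (int \<Rightarrow> complex)) \<Rightarrow>
   (('s \<Rightarrow> complex) \<Rightarrow> complex) set" where
  "meas_ker S \<Theta> = {\<Phi> \<in> meas S. \<Theta> \<Phi> = (\<lambda>_. 0)}"

definition weak_star_closed ::
  "'s topology \<Rightarrow> (('s \<Rightarrow> complex) \<Rightarrow> complex) set \<Rightarrow> bool" where
  "weak_star_closed S N \<longleftrightarrow> closedin (weak_star_topology (topspace S) (cont_funs S)) N"

definition pre_annihilator ::
  "'s topology \<Rightarrow> (('s \<Rightarrow> complex) \<Rightarrow> complex) set \<Rightarrow> ('s \<Rightarrow> complex) set" where
  "pre_annihilator S N = {f \<in> cont_funs S. \<forall>\<Psi>\<in>N. \<Psi> f = 0}"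

definition restrict_to_int :: "(int \<Rightarrow> 's) \<Rightarrow> ('s \<Rightarrow> complex) set \<Rightarrow> (int \<Rightarrow> complex) set" where
  "restrict_to_int j F = (\<lambda>f. f \<circ> j) ` F"

end

theory Submission imports Defs begin

text \<open>For (1), the bipolar theorem gives $\ker\Theta = ({}^\perp\ker\Theta)^\perp$. A measure
  \<open>\<Psi>\<close> and $\Theta(\Psi)$ agree on $F = {}^\perp\ker\Theta$, so a Hahn-Banach extension of a
  functional on \<open>F\<close> to $C(S)$, followed by \<open>\<Theta>\<close>, inverts $\iota_F$; injectivity is the bipolar
  theorem. Shift invariance holds because $\ker\Theta$ is stable under convolution with the point
  masses at integers.

  For (2), \<open>E\<close> is stable under the action of $\ell_1(Z)$, so convolution is separately
  weak$^*$-continuous on $\ell_1(Z) = E^*$. Take for \<open>S\<close> the weak$^*$-closure of the unit vectors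
  and for \<open>\<Theta>\<close> the adjoint of the embedding of \<open>E\<close> into $C(S)$, i.e. the map that sends a measure
  to its barycentre. Measures convolve as their barycentres do since \<open>E\<close> is a module.
  Hahn-Banach separation identifies the pre-annihilator of the kernel with \<open>E\<close>.\<close>

section \<open>Duals of sup-normed function spaces\<close>

text \<open>The inner integral in \<open>meas_conv\<close> has to be continuous, for which
  Grothendieck's theorem is the usual tool. In (1) only convolutions with point masses of integers
  are examined, and there the inner integral is plain evaluation. The predual is not assumed
  isometric, so in (2) the unit ball of \<open>ell1\<close> need not be weak-star compact;
  compactness comes instead from the unit ball of the dual of \<open>E\<close>, which contains the
  images of all unit vectors, and the isomorphism constant enters only the bound of \<Theta>. Since
  the compactification is realized inside \<open>ell1\<close>, each of its points is its own
  barycentre, which settles the injectivity claim. Members of \<open>cont_funs\<close> are arbitrary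
  off the carrier, so functions known to agree only on the carrier are exchanged under a functional
  by \<open>dual_space_cong\<close>.\<close>

lemma complex_subspaceD:
  assumes "complex_subspace V"
  shows "(\<lambda>_. 0) \<in> V"
    and "f \<in> V \<Longrightarrow> g \<in> V \<Longrightarrow> (\<lambda>i. f i + g i) \<in> V"
    and "f \<in> V \<Longrightarrow> (\<lambda>i. c * f i) \<in> V"
    and "f \<in> V \<Longrightarrow> g \<in> V \<Longrightarrow> (\<lambda>i. f i + c * g i) \<in> V"
    and "f \<in> V \<Longrightarrow> g \<in> V \<Longrightarrow> (\<lambda>i. f i - g i) \<in> V"
proof -
  show "(\<lambda>_. 0) \<in> V"
    and add: "\<And>f g. f \<in> V \<Longrightarrow> g \<in> V \<Longrightarrow> (\<lambda>i. f i + g i) \<in> V"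
    and scale: "\<And>f c. f \<in> V \<Longrightarrow> (\<lambda>i. c * f i) \<in> V"
    using assms by (auto simp: complex_subspace_def)
  show comb: "f \<in> V \<Longrightarrow> g \<in> V \<Longrightarrow> (\<lambda>i. f i + c * g i) \<in> V" for f g c
    using add[of f "\<lambda>i. c * g i"] scale by blast
  show "f \<in> V \<Longrightarrow> g \<in> V \<Longrightarrow> (\<lambda>i. f i - g i) \<in> V"
    using comb[of f g "-1"] by simp
qed

section \<open>Supremum seminorms\<close>

lemma sup_norm_upper:
  assumes "bounded (f ` A)" "i \<in> A"
  shows "norm (f i) \<le> sup_norm A f"
  unfolding sup_norm_def
  by (rule cSUP_upper) (use assms in \<open>auto simp: bdd_above_def bounded_iff\<close>)

lemma sup_norm_least:
  assumes "A \<noteq> {}" "\<And>i. i \<in> A \<Longrightarrow> norm (f i) \<le> K"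
  shows "sup_norm A f \<le> K"
  unfolding sup_norm_def using assms by (intro cSUP_least) auto

lemma sup_norm_nonneg:
  assumes "A \<noteq> {}" "bounded (f ` A)"
  shows "0 \<le> sup_norm A f"
proof -
  obtain i where "i \<in> A" using assms(1) by blast
  then show ?thesis using sup_norm_upper[OF assms(2)] norm_ge_zero order_trans by blast
qed

lemma sup_norm_add:
  assumes "A \<noteq> {}" "bounded (f ` A)" "bounded (g ` A)"
  shows "sup_norm A (\<lambda>i. f i + g i) \<le> sup_norm A f + sup_norm A g"
  by (rule sup_norm_least[OF assms(1)])
     (meson add_mono assms(2,3) norm_triangle_le sup_norm_upper)

lemma sup_norm_scale:
  assumes "A \<noteq> {}" "bounded (f ` A)"
  shows "sup_norm A (\<lambda>i. c * f i) = norm c * sup_norm A f"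
proof (rule antisym)
  show "sup_norm A (\<lambda>i. c * f i) \<le> norm c * sup_norm A f"
    using assms by (intro sup_norm_least) (auto simp: norm_mult intro!: mult_left_mono sup_norm_upper)
  show "norm c * sup_norm A f \<le> sup_norm A (\<lambda>i. c * f i)"
  proof (cases "c = 0")
    case True
    then show ?thesis using assms(1) by (simp add: sup_norm_def)
  next
    case False
    have "bounded ((\<lambda>i. c * f i) ` A)"
      using bounded_scaling[of "f ` A"] bounded_linear_image[OF assms(2) bounded_linear_mult_right[of c]]
      by (simp add: image_image)
    then have "norm (f i) \<le> sup_norm A (\<lambda>i. c * f i) / norm c" if "i \<in> A" for i
      using sup_norm_upper[of "\<lambda>i. c * f i" A i] that False
      by (simp add: norm_mult field_simps)
    then have "sup_norm A f \<le> sup_norm A (\<lambda>i. c * f i) / norm c"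
      using assms(1) by (intro sup_norm_least) auto
    then show ?thesis using False by (simp add: field_simps)
  qed
qed

section \<open>Bounded functionals and the dual norm\<close>

lemma dual_spaceD:
  assumes "\<phi> \<in> dual_space A V"
  shows "f \<in> V \<Longrightarrow> g \<in> V \<Longrightarrow> \<phi> (\<lambda>i. f i + g i) = \<phi> f + \<phi> g"
    and "f \<in> V \<Longrightarrow> \<phi> (\<lambda>i. c * f i) = c * \<phi> f"
    and "f \<notin> V \<Longrightarrow> \<phi> f = 0"
    and "\<exists>K. \<forall>f\<in>V. norm (\<phi> f) \<le> K * sup_norm A f"
  using assms by (auto simp: dual_space_def)

lemma dual_spaceI:
  assumes "\<And>f g. f \<in> V \<Longrightarrow> g \<in> V \<Longrightarrow> \<phi> (\<lambda>i. f i + g i) = \<phi> f + \<phi> g"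
    and "\<And>c f. f \<in> V \<Longrightarrow> \<phi> (\<lambda>i. c * f i) = c * \<phi> f"
    and "\<And>f. f \<in> V \<Longrightarrow> norm (\<phi> f) \<le> K * sup_norm A f"
    and "\<And>f. f \<notin> V \<Longrightarrow> \<phi> f = 0"
  shows "\<phi> \<in> dual_space A V"
  using assms unfolding dual_space_def by blast

lemma dual_space_comb:
  assumes "\<phi> \<in> dual_space A V" "complex_subspace V" "f \<in> V" "g \<in> V"
  shows "\<phi> (\<lambda>i. f i + c * g i) = \<phi> f + c * \<phi> g"
    and "\<phi> (\<lambda>i. f i - g i) = \<phi> f - \<phi> g"
proof -
  show comb: "\<phi> (\<lambda>i. f i + c * g i) = \<phi> f + c * \<phi> g" for c
    using dual_spaceD(1)[OF assms(1,3) complex_subspaceD(3)[OF assms(2,4)]] dual_spaceD(2)[OF assms(1,4)] by simp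
  show "\<phi> (\<lambda>i. f i - g i) = \<phi> f - \<phi> g"
    using comb[of "-1"] by simp
qed

lemma complex_subspace_dual_space: "complex_subspace (dual_space A V)"
proof -
  have "(\<lambda>f. \<phi> f + \<psi> f) \<in> dual_space A V"
    if \<phi>: "\<phi> \<in> dual_space A V" and \<psi>: "\<psi> \<in> dual_space A V" for \<phi> \<psi>
  proof -
    obtain K L where KL: "\<And>f. f \<in> V \<Longrightarrow> norm (\<phi> f) \<le> K * sup_norm A f"
      "\<And>f. f \<in> V \<Longrightarrow> norm (\<psi> f) \<le> L * sup_norm A f"
      using dual_spaceD(4)[OF \<phi>] dual_spaceD(4)[OF \<psi>] by blast
    have "norm (\<phi> f + \<psi> f) \<le> (K + L) * sup_norm A f" if "f \<in> V" for f
      using norm_triangle_mono[OF KL(1)[OF that] KL(2)[OF that]] by (simp add: algebra_simps)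
    then show ?thesis
      using dual_spaceD[OF \<phi>] dual_spaceD[OF \<psi>]
      by (intro dual_spaceI[where K = "K + L"]) (simp_all add: algebra_simps)
  qed
  moreover have "(\<lambda>f. c * \<phi> f) \<in> dual_space A V" if \<phi>: "\<phi> \<in> dual_space A V" for c \<phi>
  proof -
    obtain K where K: "\<And>f. f \<in> V \<Longrightarrow> norm (\<phi> f) \<le> K * sup_norm A f"
      using dual_spaceD(4)[OF \<phi>] by blast
    have "norm (c * \<phi> f) \<le> (norm c * K) * sup_norm A f" if "f \<in> V" for f
      using mult_left_mono[OF K[OF that] norm_ge_zero[of c]] by (simp add: norm_mult mult.assoc)
    then show ?thesis
      using dual_spaceD[OF \<phi>]
      by (intro dual_spaceI[where K = "norm c * K"]) (simp_all add: algebra_simps)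
  qed
  moreover have "(\<lambda>_. 0) \<in> dual_space A V"
    by (rule dual_spaceI[where K = 0]) simp_all
  ultimately show ?thesis by (simp add: complex_subspace_def)
qed

text \<open>\<open>dual_norm\<close> is a supremum of reals and says nothing without an upper bound.
  The constant supplied by \<open>dual_space\<close> may be negative, hence the absolute value in
  the bound.\<close>

lemma bdd_above_dual_norm:
  assumes \<phi>: "\<phi> \<in> dual_space A V" and A: "A \<noteq> {}" and bdd: "\<And>f. f \<in> V \<Longrightarrow> bounded (f ` A)"
  shows "bdd_above ((\<lambda>f. norm (\<phi> f)) ` {f \<in> V. sup_norm A f \<le> 1})"
proof -
  obtain K where K: "\<And>f. f \<in> V \<Longrightarrow> norm (\<phi> f) \<le> K * sup_norm A f"
    using dual_spaceD(4)[OF \<phi>] by blast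
  have "norm (\<phi> g) \<le> \<bar>K\<bar>" if "g \<in> V" "sup_norm A g \<le> 1" for g
  proof -
    have "K * sup_norm A g \<le> \<bar>K\<bar> * 1"
      using that sup_norm_nonneg[OF A bdd[OF that(1)]] by (intro mult_mono) auto
    then show ?thesis using K[OF that(1)] by simp
  qed
  then show ?thesis
    by (auto simp: bdd_above_def)
qed

lemma dual_norm_upper:
  assumes \<phi>: "\<phi> \<in> dual_space A V" and V: "complex_subspace V" and A: "A \<noteq> {}"
    and bdd: "\<And>f. f \<in> V \<Longrightarrow> bounded (f ` A)" and f: "f \<in> V"
  shows "norm (\<phi> f) \<le> dual_norm A V \<phi> * sup_norm A f"
proof -
  note bd = bdd_above_dual_norm[OF \<phi> A bdd]
  show ?thesis
  proof (cases "sup_norm A f = 0")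
    \<comment> \<open>Here \<open>f\<close> cannot be normalised, but any bound of \<phi> by a
      multiple of the seminorm already forces \<open>\<phi> f = 0\<close>.\<close>
    case True
    then show ?thesis using dual_spaceD(4)[OF \<phi>] f by auto
  next
    case False
    then have pos: "sup_norm A f > 0" using sup_norm_nonneg[OF A bdd[OF f]] by simp
    define c where "c = complex_of_real (1 / sup_norm A f)"
    have nc: "norm c = 1 / sup_norm A f"
      using pos unfolding c_def norm_of_real by simp
    have "(\<lambda>i. c * f i) \<in> {f \<in> V. sup_norm A f \<le> 1}"
      using complex_subspaceD(3)[OF V f] sup_norm_scale[OF A bdd[OF f]] nc pos by simp
    from cSUP_upper[OF this bd] have "norm (\<phi> (\<lambda>i. c * f i)) \<le> dual_norm A V \<phi>"
      by (simp add: dual_norm_def)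
    then have "norm c * norm (\<phi> f) \<le> dual_norm A V \<phi>"
      using dual_spaceD(2)[OF \<phi> f] by (simp add: norm_mult)
    then show ?thesis using pos nc by (simp add: field_simps)
  qed
qed

lemma dual_norm_least:
  assumes V: "complex_subspace V" and A: "A \<noteq> {}" and K: "0 \<le> K"
    and le: "\<And>f. f \<in> V \<Longrightarrow> norm (\<phi> f) \<le> K * sup_norm A f"
  shows "dual_norm A V \<phi> \<le> K"
  unfolding dual_norm_def
proof (rule cSUP_least)
  have "sup_norm A (\<lambda>_. 0) \<le> 1" using A by (simp add: sup_norm_def)
  then show "{f \<in> V. sup_norm A f \<le> 1} \<noteq> {}" using complex_subspaceD(1)[OF V] by blast
  show "norm (\<phi> f) \<le> K" if "f \<in> {f \<in> V. sup_norm A f \<le> 1}" for f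
    using le[of f] that mult_left_mono[of "sup_norm A f" 1 K] K by auto
qed

lemma dual_norm_nonneg:
  assumes "\<phi> \<in> dual_space A V" "complex_subspace V" "A \<noteq> {}"
    and "\<And>f. f \<in> V \<Longrightarrow> bounded (f ` A)"
  shows "0 \<le> dual_norm A V \<phi>"
proof -
  have "(\<lambda>_. 0) \<in> {f \<in> V. sup_norm A f \<le> 1}"
    using complex_subspaceD(1)[OF assms(2)] assms(3) by (simp add: sup_norm_def)
  from cSUP_upper[OF this bdd_above_dual_norm[OF assms(1,3,4)]]
  have "norm (\<phi> (\<lambda>_. 0)) \<le> dual_norm A V \<phi>" by (simp add: dual_norm_def)
  then show ?thesis using norm_ge_zero order_trans by blast
qed

text \<open>The seminorm over \<open>A\<close> of the difference is 0, so no bounded functional sees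
  what happens off \<open>A\<close>. This is how functions that match a continuous function on the
  carrier only are handled below.\<close>

lemma dual_space_cong:
  assumes \<phi>: "\<phi> \<in> dual_space A V" and V: "complex_subspace V" and A: "A \<noteq> {}"
    and fg: "f \<in> V" "g \<in> V" "\<And>i. i \<in> A \<Longrightarrow> f i = g i"
  shows "\<phi> f = \<phi> g"
proof -
  obtain K where K: "\<And>f. f \<in> V \<Longrightarrow> norm (\<phi> f) \<le> K * sup_norm A f"
    using dual_spaceD(4)[OF \<phi>] by blast
  have "sup_norm A (\<lambda>i. f i - g i) = 0"
    using fg(3) A by (simp add: sup_norm_def)
  then have "norm (\<phi> (\<lambda>i. f i - g i)) \<le> 0"
    using K[OF complex_subspaceD(5)[OF V fg(1,2)]] by simp
  then show ?thesis using dual_space_comb(2)[OF \<phi> V fg(1,2)] by simp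
qed

section \<open>Hahn-Banach extension\<close>

text \<open>Partial functionals are represented by their graphs. A graph closed under linear
  combinations and dominated by a sublinear functional is automatically single-valued.\<close>

lemma hahn_banach_real:
  fixes p :: "('i \<Rightarrow> complex) \<Rightarrow> real" and G :: "(('i \<Rightarrow> complex) \<times> real) set"
  assumes V: "complex_subspace V"
    and p_add: "\<And>f g. f \<in> V \<Longrightarrow> g \<in> V \<Longrightarrow> p (\<lambda>i. f i + g i) \<le> p f + p g"
    and p_scale: "\<And>c f. f \<in> V \<Longrightarrow> 0 \<le> c \<Longrightarrow> p (\<lambda>i. of_real c * f i) = c * p f"
    and "G \<noteq> {}" "Domain G \<subseteq> V"
    and "\<And>f a g b c. (f, a) \<in> G \<Longrightarrow> (g, b) \<in> G \<Longrightarrow> (\<lambda>i. f i + of_real c * g i, a + c * b) \<in> G"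
    and "\<And>f a. (f, a) \<in> G \<Longrightarrow> a \<le> p f"
  obtains u where "\<And>f g c. f \<in> V \<Longrightarrow> g \<in> V \<Longrightarrow> u (\<lambda>i. f i + of_real c * g i) = u f + c * u g"
    and "\<And>f. f \<in> V \<Longrightarrow> u f \<le> p f" and "\<And>f a. (f, a) \<in> G \<Longrightarrow> u f = a"
proof -
  define L where "L H \<longleftrightarrow> (\<forall>f a g b c. (f, a) \<in> H \<longrightarrow> (g, b) \<in> H \<longrightarrow>
    (\<lambda>i. f i + of_real c * g i, a + c * b) \<in> H)" for H :: "(('i \<Rightarrow> complex) \<times> real) set"
  have L_intro: "L H" if "\<And>f a g b c. (f, a) \<in> H \<Longrightarrow> (g, b) \<in> H \<Longrightarrow>
      (\<lambda>i. f i + of_real c * g i, a + c * b) \<in> H" for H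
    unfolding L_def by (intro allI impI, rule that)
  have L_elim: "(\<lambda>i. f i + of_real c * g i, a + c * b) \<in> H"
    if "L H" "(f, a) \<in> H" "(g, b) \<in> H" for H f a g b c
    by (rule that(1)[unfolded L_def, rule_format, OF that(2,3)])
  \<comment> \<open>Zorn's lemma runs over the dominated real-linear graphs that extend
    \<open>G\<close>. A union of a chain stays linear because two pairs always lie in a common
    member.\<close>
  define \<H> where "\<H> = {H. G \<subseteq> H \<and> Domain H \<subseteq> V \<and> L H \<and> (\<forall>f a. (f, a) \<in> H \<longrightarrow> a \<le> p f)}"
  have "L G" by (rule L_intro) (rule assms(6))
  then have "G \<in> \<H>" using assms(5,7) unfolding \<H>_def by blast
  have "\<exists>M\<in>\<H>. \<forall>X\<in>\<H>. M \<subseteq> X \<longrightarrow> X = M"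
  proof (rule subset_Zorn_nonempty)
    show "\<H> \<noteq> {}" using \<open>G \<in> \<H>\<close> by blast
    fix \<C> assume ne: "\<C> \<noteq> {}" and chain: "subset.chain \<H> \<C>"
    have sub: "\<C> \<subseteq> \<H>" and cmp: "\<And>X Y. X \<in> \<C> \<Longrightarrow> Y \<in> \<C> \<Longrightarrow> X \<subseteq> Y \<or> Y \<subseteq> X"
      using chain by (auto simp: subset_chain_def)
    have "L (\<Union>\<C>)"
    proof (rule L_intro)
      fix f a g b and c :: real assume "(f, a) \<in> \<Union>\<C>" "(g, b) \<in> \<Union>\<C>"
      then obtain Y Z where "Y \<in> \<C>" "(f, a) \<in> Y" "Z \<in> \<C>" "(g, b) \<in> Z"
        by blast
      then obtain X where X: "X \<in> \<C>" "(f, a) \<in> X" "(g, b) \<in> X"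
        using cmp[of Y Z] by blast
      moreover have "L X" using X(1) sub by (auto simp: \<H>_def)
      ultimately show "(\<lambda>i. f i + of_real c * g i, a + c * b) \<in> \<Union>\<C>"
        using L_elim[of X f a g b c] by blast
    qed
    then show "\<Union>\<C> \<in> \<H>" using sub ne unfolding \<H>_def by blast
  qed
  then obtain M where "M \<in> \<H>" and max: "\<And>X. X \<in> \<H> \<Longrightarrow> M \<subseteq> X \<Longrightarrow> X = M" by blast
  have GM: "G \<subseteq> M" and MV: "\<And>f a. (f, a) \<in> M \<Longrightarrow> f \<in> V" and "L M"
    and dom: "\<And>f a. (f, a) \<in> M \<Longrightarrow> a \<le> p f"
    using \<open>M \<in> \<H>\<close> unfolding \<H>_def by blast+
  note lin = L_elim[OF \<open>L M\<close>]
  obtain f1 a1 where "(f1, a1) \<in> M" using GM assms(4) by auto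
  from lin[OF this this, of "-1"] have zero: "(\<lambda>_. 0, 0) \<in> M" by simp
  have scale: "(\<lambda>i. of_real c * f i, c * a) \<in> M" if "(f, a) \<in> M" for f a and c :: real
    using lin[OF zero that, of c] by simp
  have Vsub: "(\<lambda>i. f i + of_real c * g i) \<in> V" if "f \<in> V" "g \<in> V" for f g and c :: real
    using complex_subspaceD(4)[OF V that] .
  have total: "\<exists>a. (h, a) \<in> M" if h: "h \<in> V" for h
  proof -
    have sep: "a - p (\<lambda>i. f i - h i) \<le> p (\<lambda>i. g i + h i) - b"
      if "(f, a) \<in> M" "(g, b) \<in> M" for f a g b
    proof -
      have "a + b \<le> p (\<lambda>i. f i + g i)"
        using dom[OF lin[OF that, of 1]] by simp
      also have "(\<lambda>i. f i + g i) = (\<lambda>i. (f i - h i) + (g i + h i))" by simp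
      also have "p \<dots> \<le> p (\<lambda>i. f i - h i) + p (\<lambda>i. g i + h i)"
        using MV[OF that(1)] MV[OF that(2)] h by (intro p_add complex_subspaceD[OF V])
      finally show ?thesis by simp
    qed
    \<comment> \<open>The value at \<open>h\<close> has to lie above every
      \<open>a - p (f - h)\<close> and below every \<open>p (g + h) - b\<close>. By
      \<open>sep\<close> the supremum of the lower bounds does.\<close>
    define \<gamma> where "\<gamma> = (SUP z\<in>M. snd z - p (\<lambda>i. fst z i - h i))"
    have up: "a - p (\<lambda>i. f i - h i) \<le> \<gamma>" if "(f, a) \<in> M" for f a
    proof -
      have "bdd_above ((\<lambda>z. snd z - p (\<lambda>i. fst z i - h i)) ` M)"
        using sep[OF _ zero] by (intro bdd_aboveI2[where M = "p (\<lambda>i. 0 + h i) - 0"]) auto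
      from cSUP_upper[OF that this] show ?thesis by (simp add: \<gamma>_def)
    qed
    have lo: "\<gamma> \<le> p (\<lambda>i. g i + h i) - b" if "(g, b) \<in> M" for g b
      unfolding \<gamma>_def using zero sep[OF _ that] by (intro cSUP_least) auto
    define M' where "M' = {(\<lambda>i. f i + of_real c * h i, a + c * \<gamma>) | f a c. (f, a) \<in> M}"
    have "(f, a) \<in> M'" if "(f, a) \<in> M" for f a
    proof -
      have "(\<lambda>i. f i + of_real 0 * h i, a + 0 * \<gamma>) \<in> M'"
        using that unfolding M'_def by blast
      then show ?thesis by simp
    qed
    then have MM': "M \<subseteq> M'" by auto
    have dom': "a + c * \<gamma> \<le> p (\<lambda>i. f i + of_real c * h i)" if fa: "(f, a) \<in> M" for f a c
    proof -
      \<comment> \<open>Dividing by \<open>\<bar>c\<bar>\<close> reduces to the coefficients 1 and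
        -1, where \<open>lo\<close> and \<open>up\<close> apply; positive homogeneity of
        \<open>p\<close> scales back.\<close>
      consider "c = 0" | "c > 0" | "c < 0" by linarith
      then show ?thesis
      proof cases
        case 1
        then show ?thesis using dom[OF fa] by simp
      next
        case 2
        let ?g = "\<lambda>i. of_real (1 / c) * f i"
        have g: "(?g, 1 / c * a) \<in> M" by (rule scale[OF fa])
        have "c * \<gamma> \<le> c * (p (\<lambda>i. ?g i + h i) - 1 / c * a)"
          using lo[OF g] 2 by (intro mult_left_mono) auto
        also have "\<dots> = c * p (\<lambda>i. ?g i + h i) - a" using 2 by (simp add: field_simps)
        also have "c * p (\<lambda>i. ?g i + h i) = p (\<lambda>i. of_real c * (?g i + h i))"
          using 2 p_scale[OF complex_subspaceD(2)[OF V MV[OF g] h], of c] by simp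
        also have "(\<lambda>i. of_real c * (?g i + h i)) = (\<lambda>i. f i + of_real c * h i)"
          using 2 by (auto simp: fun_eq_iff field_simps)
        finally show ?thesis by simp
      next
        case 3
        let ?g = "\<lambda>i. of_real (1 / - c) * f i"
        have g: "(?g, 1 / - c * a) \<in> M" by (rule scale[OF fa])
        have "- c * (1 / - c * a - p (\<lambda>i. ?g i - h i)) \<le> - c * \<gamma>"
          using up[OF g] 3 by (intro mult_left_mono) auto
        also have "- c * (1 / - c * a - p (\<lambda>i. ?g i - h i)) = a - (- c) * p (\<lambda>i. ?g i - h i)"
          using 3 by (simp add: field_simps)
        also have "(- c) * p (\<lambda>i. ?g i - h i) = p (\<lambda>i. of_real (- c) * (?g i - h i))"
          using 3 p_scale[OF complex_subspaceD(5)[OF V MV[OF g] h], of "- c"] by simp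
        also have "(\<lambda>i. of_real (- c) * (?g i - h i)) = (\<lambda>i. f i + of_real c * h i)"
          using 3 by (auto simp: fun_eq_iff field_simps)
        finally show ?thesis by simp
      qed
    qed
    have lin': "(\<lambda>i. f' i + of_real d * g' i, a' + d * b') \<in> M'"
      if "(f', a') \<in> M'" "(g', b') \<in> M'" for f' a' g' b' d
    proof -
      obtain f a c where f: "(f, a) \<in> M" "f' = (\<lambda>i. f i + of_real c * h i)" "a' = a + c * \<gamma>"
        using \<open>(f', a') \<in> M'\<close> by (auto simp: M'_def)
      obtain g b e where g: "(g, b) \<in> M" "g' = (\<lambda>i. g i + of_real e * h i)" "b' = b + e * \<gamma>"
        using \<open>(g', b') \<in> M'\<close> by (auto simp: M'_def)
      have "(\<lambda>i. (f i + of_real d * g i) + of_real (c + d * e) * h i, (a + d * b) + (c + d * e) * \<gamma>) \<in> M'"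
        unfolding M'_def mem_Collect_eq
        by (intro exI conjI) (rule refl, rule lin[OF f(1) g(1), of d])
      then show ?thesis by (simp add: f g algebra_simps)
    qed
    have "Domain M' \<subseteq> V"
      unfolding M'_def using Vsub[OF MV h] by blast
    moreover have "G \<subseteq> M'" using GM MM' by blast
    moreover have "a \<le> p f" if "(f, a) \<in> M'" for f a
      using that dom' by (auto simp: M'_def)
    moreover have "L M'" by (rule L_intro) (rule lin')
    ultimately have "M' \<in> \<H>" unfolding \<H>_def by blast
    then have "M' = M" using max MM' by blast
    moreover have "(\<lambda>i. 0 + of_real 1 * h i, 0 + 1 * \<gamma>) \<in> M'" unfolding M'_def mem_Collect_eq
      by (intro exI conjI) (rule refl, rule zero)
    ultimately show ?thesis by auto
  qed
  \<comment> \<open>Both differences of the two values sit over the zero function, so domination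
    bounds each of them by \<open>p 0 = 0\<close>.\<close>
  have unique: "a = b" if "(f, a) \<in> M" "(f, b) \<in> M" for f a b
  proof -
    have "p (\<lambda>_. 0) = 0" using p_scale[of "\<lambda>_. 0" 0] complex_subspaceD(1)[OF V] by simp
    then show ?thesis
      using dom[OF lin[OF that, of "-1"]] dom[OF lin[OF that(2,1), of "-1"]] by simp
  qed
  define u where "u f = (THE a. (f, a) \<in> M)" for f
  have u: "u f = a" if "(f, a) \<in> M" for f a
    unfolding u_def by (rule the_equality, rule that, rule unique[OF _ that])
  have uM: "(f, u f) \<in> M" if "f \<in> V" for f
    using total[OF that] u by auto
  show thesis
  proof
    show "u (\<lambda>i. f i + of_real c * g i) = u f + c * u g" if "f \<in> V" "g \<in> V" for f g c
      by (rule u[OF lin[OF uM[OF that(1)] uM[OF that(2)]]])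
    show "u f \<le> p f" if "f \<in> V" for f using dom uM[OF that] by blast
    show "u f = a" if "(f, a) \<in> G" for f a using u GM that by blast
  qed
qed

text \<open>A complex-linear functional is determined by its real part u, its imaginary part being
  -u(i f). It is therefore enough to extend the real part and to rebuild \<psi> by this
  formula.\<close>

lemma hahn_banach_dual_space:
  assumes V: "complex_subspace V" and A: "A \<noteq> {}"
    and bdd: "\<And>f. f \<in> V \<Longrightarrow> bounded (f ` A)" and K: "0 \<le> K"
    and ne: "G \<noteq> {}" and GV: "Domain G \<subseteq> V"
    and lin: "\<And>f a g b c. (f, a) \<in> G \<Longrightarrow> (g, b) \<in> G \<Longrightarrow> (\<lambda>i. f i + c * g i, a + c * b) \<in> G"
    and dom: "\<And>f a. (f, a) \<in> G \<Longrightarrow> norm a \<le> K * sup_norm A f"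
  obtains \<psi> where "\<psi> \<in> dual_space A V" "\<And>f. f \<in> V \<Longrightarrow> norm (\<psi> f) \<le> K * sup_norm A f"
    "\<And>f a. (f, a) \<in> G \<Longrightarrow> \<psi> f = a"
proof -
  let ?p = "\<lambda>f. K * sup_norm A f"
  let ?G = "{(f, Re a) | f a. (f, a) \<in> G}"
  have p_scale: "?p (\<lambda>i. c * f i) = norm c * ?p f" if "f \<in> V" for c f
    using sup_norm_scale[OF A bdd[OF that]] by simp
  obtain u where u_lin: "\<And>f g c. f \<in> V \<Longrightarrow> g \<in> V \<Longrightarrow> u (\<lambda>i. f i + of_real c * g i) = u f + c * u g"
    and u_dom: "\<And>f. f \<in> V \<Longrightarrow> u f \<le> ?p f" and u_ext: "\<And>f a. (f, a) \<in> ?G \<Longrightarrow> u f = a"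
  proof (rule hahn_banach_real[OF V, of ?p ?G])
    show "?p (\<lambda>i. f i + g i) \<le> ?p f + ?p g" if "f \<in> V" "g \<in> V" for f g
      using mult_left_mono[OF sup_norm_add[OF A bdd[OF that(1)] bdd[OF that(2)]] K]
      by (simp add: algebra_simps)
    show "?p (\<lambda>i. of_real c * f i) = c * ?p f" if "f \<in> V" "0 \<le> c" for c f
      using p_scale[OF that(1), of "of_real c"] that(2) by (simp only: norm_of_real abs_of_nonneg)
    show "?G \<noteq> {}" "Domain ?G \<subseteq> V" using ne GV by auto
    show "(\<lambda>i. f i + of_real c * g i, a + c * b) \<in> ?G" if "(f, a) \<in> ?G" "(g, b) \<in> ?G" for f a g b c
    proof -
      from that(1) obtain a' where a': "(f, a') \<in> G" "a = Re a'" by blast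
      from that(2) obtain b' where b': "(g, b') \<in> G" "b = Re b'" by blast
      have "(\<lambda>i. f i + of_real c * g i, Re (a' + of_real c * b')) \<in> ?G"
        using lin[OF a'(1) b'(1), of "of_real c"] by blast
      then show ?thesis by (simp add: a'(2) b'(2))
    qed
    show "a \<le> ?p f" if "(f, a) \<in> ?G" for f a
    proof -
      from that obtain a' where "(f, a') \<in> G" "a = Re a'" by blast
      then show ?thesis using dom[of f a'] complex_Re_le_cmod[of a'] by linarith
    qed
  qed (rule that)
  have u_add: "u (\<lambda>i. f i + g i) = u f + u g" if "f \<in> V" "g \<in> V" for f g
    using u_lin[OF that, of 1] by simp
  have "u (\<lambda>_. 0) = 0" using u_add[of "\<lambda>_. 0" "\<lambda>_. 0"] complex_subspaceD(1)[OF V] by simp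
  then have u_scale: "u (\<lambda>i. of_real c * f i) = c * u f" if "f \<in> V" for f c
    using u_lin[OF complex_subspaceD(1)[OF V] that, of c] by simp
  define \<psi> where "\<psi> f = (if f \<in> V then Complex (u f) (- u (\<lambda>i. \<i> * f i)) else 0)" for f
  have \<psi>_add: "\<psi> (\<lambda>i. f i + g i) = \<psi> f + \<psi> g" if "f \<in> V" "g \<in> V" for f g
    using that u_add[OF that] u_add[OF complex_subspaceD(3)[OF V that(1)] complex_subspaceD(3)[OF V that(2)], of \<i> \<i>]
      complex_subspaceD(2)[OF V that]
    by (simp add: \<psi>_def complex_eq_iff algebra_simps)
  have \<psi>_scale: "\<psi> (\<lambda>i. c * f i) = c * \<psi> f" if f: "f \<in> V" for c f
  proof -
    have if': "(\<lambda>i. \<i> * f i) \<in> V" by (rule complex_subspaceD(3)[OF V f])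
    have 1: "(\<lambda>i. c * f i) = (\<lambda>i. of_real (Re c) * f i + of_real (Im c) * (\<i> * f i))"
      by (simp add: fun_eq_iff complex_eq_iff)
    have 2: "(\<lambda>i. \<i> * (c * f i)) = (\<lambda>i. of_real (Re c) * (\<i> * f i) + of_real (- Im c) * f i)"
      by (simp add: fun_eq_iff complex_eq_iff)
    have "u (\<lambda>i. c * f i) = Re c * u f + Im c * u (\<lambda>i. \<i> * f i)"
      unfolding 1 using u_lin[OF complex_subspaceD(3)[OF V f] if'] u_scale[OF f] by simp
    moreover have "u (\<lambda>i. \<i> * (c * f i)) = Re c * u (\<lambda>i. \<i> * f i) + (- Im c) * u f"
      unfolding 2 by (simp only: u_lin[OF complex_subspaceD(3)[OF V if'] f] u_scale[OF if'])
    ultimately show ?thesis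
      using f complex_subspaceD(3)[OF V f] by (simp add: \<psi>_def complex_eq_iff)
  qed
  have \<psi>_dom: "norm (\<psi> f) \<le> K * sup_norm A f" if f: "f \<in> V" for f
  proof -
    \<comment> \<open>Rotating \<open>f\<close> by this phase turns \<open>\<psi> f\<close> into its
      modulus, so the bound on the real part bounds the modulus with the same constant
      \<open>K\<close>.\<close>
    define c where "c = cnj (sgn (\<psi> f))"
    have c: "norm c \<le> 1" by (simp add: c_def norm_sgn)
    have "c * \<psi> f = of_real (norm (\<psi> f))"
    proof (cases "\<psi> f = 0")
      case False
      have "c * \<psi> f = \<psi> f * cnj (\<psi> f) / of_real (norm (\<psi> f))"
        by (simp add: c_def sgn_eq)
      also have "\<dots> = of_real (norm (\<psi> f) ^ 2) / of_real (norm (\<psi> f))"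
        by (simp only: complex_norm_square)
      finally show ?thesis using False by (simp add: power2_eq_square)
    qed simp
    then have "norm (\<psi> f) = Re (\<psi> (\<lambda>i. c * f i))" using \<psi>_scale[OF f] by simp
    also have "\<dots> = u (\<lambda>i. c * f i)"
      using complex_subspaceD(3)[OF V f] by (simp add: \<psi>_def)
    also have "\<dots> \<le> norm c * (K * sup_norm A f)"
      using u_dom[OF complex_subspaceD(3)[OF V f]] p_scale[OF f] by simp
    also have "\<dots> \<le> 1 * (K * sup_norm A f)"
      using c K sup_norm_nonneg[OF A bdd[OF f]] by (intro mult_right_mono) auto
    finally show ?thesis by simp
  qed
  have "\<psi> f = a" if "(f, a) \<in> G" for f a
  proof -
    \<comment> \<open>The closure rule for \<open>G\<close> produces only sums
      \<open>f + c g\<close>; the coefficient \<open>\<i> - 1\<close> yields multiplication by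
      \<open>\<i>\<close>.\<close>
    have "(\<lambda>i. f i + (\<i> - 1) * f i, a + (\<i> - 1) * a) \<in> G" by (rule lin[OF that that])
    then have "(\<lambda>i. \<i> * f i, \<i> * a) \<in> G" by (simp add: algebra_simps)
    then have "u (\<lambda>i. \<i> * f i) = - Im a" using u_ext by force
    moreover have "u f = Re a" using u_ext that by force
    ultimately show ?thesis using that GV by (auto simp: \<psi>_def complex_eq_iff)
  qed
  moreover have "\<psi> \<in> dual_space A V"
    by (rule dual_spaceI[OF \<psi>_add \<psi>_scale \<psi>_dom]) (simp_all add: \<psi>_def)
  ultimately show thesis using that \<psi>_dom by blast
qed

text \<open>A linear functional that vanishes wherever finitely many evaluations vanish is a
  combination of these evaluations. It is given by its graph \<open>R\<close>, since it lives on a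
  subspace of the dual only and this subspace shrinks during the induction.\<close>

lemma finite_annihilator_representation:
  assumes V: "complex_subspace V"
    and "finite Fs" "Fs \<subseteq> V"
    and "\<And>\<Phi> a. (\<Phi>, a) \<in> R \<Longrightarrow> \<Phi> \<in> dual_space A V"
    and "\<And>\<Phi> a \<Psi> b c. (\<Phi>, a) \<in> R \<Longrightarrow> (\<Psi>, b) \<in> R \<Longrightarrow> (\<lambda>f. \<Phi> f + c * \<Psi> f, a + c * b) \<in> R"
    and "\<And>\<Phi> a. (\<Phi>, a) \<in> R \<Longrightarrow> (\<forall>f\<in>Fs. \<Phi> f = 0) \<Longrightarrow> a = 0"
  shows "\<exists>g\<in>V. \<forall>(\<Phi>, a)\<in>R. a = \<Phi> g"
  using assms(2-)
proof (induction Fs arbitrary: R)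
  case empty
  have "a = \<Phi> (\<lambda>_. 0)" if "(\<Phi>, a) \<in> R" for \<Phi> a
    using dual_spaceD(2)[OF empty(2)[OF that] complex_subspaceD(1)[OF V], of 0] empty(4)[OF that] by simp
  then show ?case by (intro bexI[OF _ complex_subspaceD(1)[OF V]]) auto
next
  case (insert h Fs)
  note dual = insert.prems(2) and lin = insert.prems(3)
  let ?R = "{(\<Phi>, a). (\<Phi>, a) \<in> R \<and> \<Phi> h = 0}"
  have "\<exists>g\<in>V. \<forall>(\<Phi>, a)\<in>?R. a = \<Phi> g"
  proof (rule insert.IH)
    show "Fs \<subseteq> V" using insert.prems by blast
    show "\<Phi> \<in> dual_space A V" if "(\<Phi>, a) \<in> ?R" for \<Phi> a
      using that dual by blast
    show "a = 0" if "(\<Phi>, a) \<in> ?R" "\<forall>f\<in>Fs. \<Phi> f = 0" for \<Phi> a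
      using that insert.prems(4)[of \<Phi> a] by simp
    show "(\<lambda>f. \<Phi> f + c * \<Psi> f, a + c * b) \<in> ?R" if "(\<Phi>, a) \<in> ?R" "(\<Psi>, b) \<in> ?R" for \<Phi> a \<Psi> b c
      using that lin[of \<Phi> a \<Psi> b c] by simp
  qed
  then obtain g where g: "g \<in> V" "\<And>\<Phi> a. (\<Phi>, a) \<in> R \<Longrightarrow> \<Phi> h = 0 \<Longrightarrow> a = \<Phi> g" by blast
  show ?case
  proof (cases "\<forall>(\<Phi>, a)\<in>R. \<Phi> h = 0")
    case True
    then show ?thesis using g by blast
  next
    case False
    then obtain \<Phi>0 a0 where 0: "(\<Phi>0, a0) \<in> R" "\<Phi>0 h \<noteq> 0" by blast
    \<comment> \<open>The coefficient of \<open>h\<close> forced by the pair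
      \<open>(\<Phi>0, a0)\<close>. Any other pair becomes one that vanishes at \<open>h\<close>
      after adding a multiple of this one, and there \<open>g\<close> is already correct.\<close>
    define d where "d = (a0 - \<Phi>0 g) / \<Phi>0 h"
    have h: "h \<in> V" using insert.prems(1) by blast
    have "a = \<Phi> (\<lambda>i. g i + d * h i)" if R: "(\<Phi>, a) \<in> R" for \<Phi> a
    proof -
      define c where "c = - \<Phi> h / \<Phi>0 h"
      have "\<Phi> h + c * \<Phi>0 h = 0" using 0(2) by (simp add: c_def)
      from g(2)[OF lin[OF R 0(1), of c] this]
      have "a = \<Phi> g - c * (a0 - \<Phi>0 g)" by (simp add: algebra_simps)
      also have "\<dots> = \<Phi> g + d * \<Phi> h" using 0(2) by (simp add: c_def d_def)
      also have "\<dots> = \<Phi> (\<lambda>i. g i + d * h i)"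
        using dual_space_comb(1)[OF dual[OF R] V g(1) h] by simp
      finally show ?thesis .
    qed
    then show ?thesis using complex_subspaceD(4)[OF V g(1) h, of d] by blast
  qed
qed

section \<open>Weak-star neighbourhoods and separation\<close>

lemma topspace_weak_star_topology:
  assumes "V \<noteq> {}"
  shows "topspace (weak_star_topology A V) = dual_space A V"
  using assms unfolding weak_star_topology_def topology_generated_by_topspace by blast

text \<open>A sub-basic set restricts a single evaluation, finite intersections collect finitely
  many, and for a union one member suffices. Recording exact agreement instead of closeness leaves a
  purely linear condition.\<close>

lemma weak_star_neighbourhood:
  assumes "openin (weak_star_topology A V) U" "\<Psi> \<in> U"
  shows "\<exists>Fs. finite Fs \<and> Fs \<subseteq> V \<and>
    (\<forall>\<Phi>\<in>dual_space A V. (\<forall>f\<in>Fs. \<Phi> f = \<Psi> f) \<longrightarrow> \<Phi> \<in> U)"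
proof -
  have "generate_topology_on {{\<phi> \<in> dual_space A V. \<phi> f \<in> U} | f U. f \<in> V \<and> open U} U"
    using assms(1) unfolding weak_star_topology_def openin_topology_generated_by_iff .
  then show ?thesis
    using assms(2)
  proof induction
    case Empty
    then show ?case by simp
  next
    case (Int a b)
    obtain F1 where F1: "finite F1" "F1 \<subseteq> V"
      "\<forall>\<Phi>\<in>dual_space A V. (\<forall>f\<in>F1. \<Phi> f = \<Psi> f) \<longrightarrow> \<Phi> \<in> a"
      using Int by auto
    obtain F2 where F2: "finite F2" "F2 \<subseteq> V"
      "\<forall>\<Phi>\<in>dual_space A V. (\<forall>f\<in>F2. \<Phi> f = \<Psi> f) \<longrightarrow> \<Phi> \<in> b"
      using Int by auto
    have "finite (F1 \<union> F2)" "F1 \<union> F2 \<subseteq> V" using F1 F2 by auto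
    moreover have "\<Phi> \<in> a \<inter> b" if "\<Phi> \<in> dual_space A V" "\<forall>f\<in>F1 \<union> F2. \<Phi> f = \<Psi> f" for \<Phi>
      using that F1(3) F2(3) by simp
    ultimately show ?case by (intro exI[of _ "F1 \<union> F2"]) simp
  next
    case (UN K)
    then obtain k where k: "k \<in> K" "\<Psi> \<in> k" by blast
    obtain Fs where Fs: "finite Fs" "Fs \<subseteq> V"
      "\<forall>\<Phi>\<in>dual_space A V. (\<forall>f\<in>Fs. \<Phi> f = \<Psi> f) \<longrightarrow> \<Phi> \<in> k"
      using UN.IH[OF k] by auto
    then show ?case using k(1) by (intro exI[of _ Fs]) auto
  next
    case (Basis s)
    then obtain f W where s: "s = {\<phi> \<in> dual_space A V. \<phi> f \<in> W}" "f \<in> V" by auto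
    then show ?case using Basis(2) by (intro exI[of _ "{f}"]) simp
  qed
qed

text \<open>A weak$^*$ neighbourhood of \<open>\<Psi>\<close> contains every functional that agrees with \<open>\<Psi>\<close> on a
  suitable finite set, so the separating element comes from finite-dimensional linear algebra
  instead of a Hahn-Banach argument in the weak$^*$ topology.\<close>

lemma weak_star_separation:
  assumes V: "complex_subspace V" and N: "complex_subspace N"
    and closed: "closedin (weak_star_topology A V) N"
    and \<Psi>: "\<Psi> \<in> dual_space A V" "\<Psi> \<notin> N"
  obtains f where "f \<in> V" "\<And>\<Phi>. \<Phi> \<in> N \<Longrightarrow> \<Phi> f = 0" "\<Psi> f \<noteq> 0"
proof -
  have top: "topspace (weak_star_topology A V) = dual_space A V"
    using complex_subspaceD(1)[OF V] by (intro topspace_weak_star_topology) blast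
  have ND: "N \<subseteq> dual_space A V" using closedin_subset[OF closed] top by simp
  have "openin (weak_star_topology A V) (dual_space A V - N)"
    using closed unfolding closedin_def top by simp
  moreover have "\<Psi> \<in> dual_space A V - N" using \<Psi> by simp
  ultimately obtain Fs where Fs: "finite Fs" "Fs \<subseteq> V"
    "\<forall>\<Phi>\<in>dual_space A V. (\<forall>f\<in>Fs. \<Phi> f = \<Psi> f) \<longrightarrow> \<Phi> \<in> dual_space A V - N"
    using weak_star_neighbourhood[of A V "dual_space A V - N" \<Psi>] by auto
  \<comment> \<open>The graph of the functional on the span of \<open>N\<close> and \<Psi> that
    kills \<open>N\<close> and takes \<Psi> to 1.\<close>
  define R where "R = {(\<lambda>f. \<Phi> f + c * \<Psi> f, c) | \<Phi> c. \<Phi> \<in> N}"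
  have RI: "(\<lambda>f. \<Phi> f + c * \<Psi> f, c) \<in> R" if "\<Phi> \<in> N" for \<Phi> c
    using that unfolding R_def by blast
  have "\<exists>g\<in>V. \<forall>(\<Phi>, a)\<in>R. a = \<Phi> g"
  proof (rule finite_annihilator_representation[OF V Fs(1,2)])
    show "\<Phi> \<in> dual_space A V" if "(\<Phi>, a) \<in> R" for \<Phi> a
    proof -
      from that obtain \<Phi>1 where "\<Phi>1 \<in> N" "\<Phi> = (\<lambda>f. \<Phi>1 f + a * \<Psi> f)" by (auto simp: R_def)
      then show ?thesis
        using complex_subspaceD(4)[OF complex_subspace_dual_space _ \<Psi>(1), of \<Phi>1 a] ND by auto
    qed
    show "(\<lambda>f. \<Phi> f + c * \<Psi>' f, a + c * b) \<in> R" if 1: "(\<Phi>, a) \<in> R" and 2: "(\<Psi>', b) \<in> R" for \<Phi> a \<Psi>' b c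
    proof -
      from 1 obtain \<Phi>1 where \<Phi>1: "\<Phi>1 \<in> N" "\<Phi> = (\<lambda>f. \<Phi>1 f + a * \<Psi> f)" by (auto simp: R_def)
      from 2 obtain \<Phi>2 where \<Phi>2: "\<Phi>2 \<in> N" "\<Psi>' = (\<lambda>f. \<Phi>2 f + b * \<Psi> f)" by (auto simp: R_def)
      have "(\<lambda>f. (\<Phi>1 f + c * \<Phi>2 f) + (a + c * b) * \<Psi> f, a + c * b) \<in> R"
        by (rule RI) (rule complex_subspaceD(4)[OF N \<Phi>1(1) \<Phi>2(1)])
      then show ?thesis by (simp add: \<Phi>1(2) \<Phi>2(2) algebra_simps)
    qed
    show "a = 0" if 1: "(\<Phi>, a) \<in> R" and 2: "\<forall>f\<in>Fs. \<Phi> f = 0" for \<Phi> a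
    \<comment> \<open>For \<open>a \<noteq> 0\<close> the element \<open>- \<Phi>1 / a\<close> of
      \<open>N\<close> would agree with \<Psi> on \<open>Fs\<close>, hence lie in the neighbourhood
      of \<Psi> that misses \<open>N\<close>.\<close>
    proof (rule ccontr)
      assume "a \<noteq> 0"
      from 1 obtain \<Phi>1 where \<Phi>1: "\<Phi>1 \<in> N" "\<Phi> = (\<lambda>f. \<Phi>1 f + a * \<Psi> f)" by (auto simp: R_def)
      have *: "(\<lambda>f. (- 1 / a) * \<Phi>1 f) \<in> N" by (rule complex_subspaceD(3)[OF N \<Phi>1(1)])
      moreover have "\<forall>f\<in>Fs. (- 1 / a) * \<Phi>1 f = \<Psi> f"
        using 2 \<open>a \<noteq> 0\<close> by (auto simp: \<Phi>1(2) field_simps add_eq_0_iff)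
      ultimately show False using bspec[OF Fs(3), of "\<lambda>f. (- 1 / a) * \<Phi>1 f"] ND by auto
    qed
  qed
  then obtain g where g: "g \<in> V" "\<And>\<Phi> a. (\<Phi>, a) \<in> R \<Longrightarrow> a = \<Phi> g" by blast
  show thesis
  proof
    show "g \<in> V" by fact
    show "\<Phi> g = 0" if "\<Phi> \<in> N" for \<Phi> using g(2)[OF RI[OF that, of 0]] by simp
    show "\<Psi> g \<noteq> 0" using g(2)[OF RI[OF complex_subspaceD(1)[OF N], of 1]] by simp
  qed
qed

section \<open>The convolution algebra of the integers and its preduals\<close>

definition pairing :: "(int \<Rightarrow> complex) \<Rightarrow> (int \<Rightarrow> complex) \<Rightarrow> complex" where
  "pairing x a = (\<Sum>\<^sub>\<infinity>n. x n * a n)"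

definition unit_vec :: "int \<Rightarrow> int \<Rightarrow> complex" where
  "unit_vec m = (\<lambda>n. if n = m then 1 else 0)"

text \<open>The action of $\ell_1(Z)$ on $\ell_\infty(Z)$ that is dual to convolution.\<close>

definition ell1_act :: "(int \<Rightarrow> complex) \<Rightarrow> (int \<Rightarrow> complex) \<Rightarrow> (int \<Rightarrow> complex)" where
  "ell1_act t x = (\<lambda>n. pairing (\<lambda>k. x (n + k)) t)"

lemma iota_eq: "iota E a = (\<lambda>x. if x \<in> E then pairing x a else 0)"
  unfolding iota_def pairing_def by (rule refl)

lemma iota_eq_pairing: "x \<in> E \<Longrightarrow> iota E a x = pairing x a"
  by (simp add: iota_eq)

lemma ell1_norm_nonneg: "0 \<le> ell1_norm a"
  by (simp add: ell1_norm_def infsum_nonneg)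

lemma norm_le_sup_norm: "x \<in> ell_inf \<Longrightarrow> norm (x n) \<le> sup_norm UNIV x"
  by (simp add: ell_inf_def sup_norm_upper)

lemma sup_norm_ell_inf_nonneg: "x \<in> ell_inf \<Longrightarrow> 0 \<le> sup_norm UNIV x"
  by (simp add: ell_inf_def sup_norm_nonneg)

lemma ell_inf_translate: "x \<in> ell_inf \<Longrightarrow> (\<lambda>k. x (n + k)) \<in> ell_inf"
  unfolding ell_inf_def by (auto simp: bounded_iff)

lemma ell_infI: "(\<And>n. norm (x n) \<le> K) \<Longrightarrow> x \<in> ell_inf"
  unfolding ell_inf_def by (auto simp: bounded_iff)

lemma pairing_abs_summable:
  assumes "x \<in> ell_inf" "a \<in> ell1"
  shows "(\<lambda>n. norm (x n * a n)) summable_on UNIV"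
proof (rule Infinite_Sum.abs_summable_on_comparison_test')
  show "(\<lambda>n. sup_norm UNIV x * norm (a n)) summable_on UNIV"
    using assms(2) by (intro summable_on_cmult_right) (simp add: ell1_def)
  show "norm (x n * a n) \<le> sup_norm UNIV x * norm (a n)" for n
    using norm_le_sup_norm[OF assms(1)] by (simp add: norm_mult mult_right_mono)
qed

lemma pairing_summable:
  assumes "x \<in> ell_inf" "a \<in> ell1"
  shows "(\<lambda>n. x n * a n) summable_on UNIV"
  using Infinite_Sum.abs_summable_summable[OF pairing_abs_summable[OF assms]] .

lemma norm_pairing_le:
  assumes a: "a \<in> ell1" and K: "\<And>n. norm (x n) \<le> K"
  shows "norm (pairing x a) \<le> K * ell1_norm a"
proof -
  have x: "x \<in> ell_inf" using K by (rule ell_infI)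
  have "norm (pairing x a) \<le> (\<Sum>\<^sub>\<infinity>n. norm (x n * a n))"
    unfolding pairing_def by (rule norm_infsum_bound[OF pairing_abs_summable[OF x a]])
  also have "\<dots> \<le> (\<Sum>\<^sub>\<infinity>n. K * norm (a n))"
  proof (rule infsum_mono)
    show "(\<lambda>n. K * norm (a n)) summable_on UNIV"
      using a by (intro summable_on_cmult_right) (simp add: ell1_def)
  qed (use pairing_abs_summable[OF x a] K in \<open>auto simp: norm_mult mult_right_mono\<close>)
  finally show ?thesis by (simp add: infsum_cmult_right' ell1_norm_def)
qed

lemma complex_subspace_ell1: "complex_subspace ell1"
proof -
  have "(\<lambda>n. a n + b n) \<in> ell1" if "a \<in> ell1" "b \<in> ell1" for a b
    using that unfolding ell1_def mem_Collect_eq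
    by (intro Infinite_Sum.abs_summable_on_comparison_test'[where g = "\<lambda>n. norm (a n) + norm (b n)"])
       (auto intro: summable_on_add norm_triangle_ineq)
  moreover have "(\<lambda>n. c * a n) \<in> ell1" if "a \<in> ell1" for a c
    using that unfolding ell1_def mem_Collect_eq norm_mult by (rule summable_on_cmult_right)
  moreover have "(\<lambda>_. 0) \<in> ell1" by (simp add: ell1_def)
  ultimately show ?thesis by (simp add: complex_subspace_def)
qed

lemma pairing_add_right:
  "x \<in> ell_inf \<Longrightarrow> a \<in> ell1 \<Longrightarrow> b \<in> ell1 \<Longrightarrow> pairing x (\<lambda>n. a n + b n) = pairing x a + pairing x b"
  unfolding pairing_def by (simp add: distrib_left infsum_add pairing_summable)

lemma pairing_add_left:
  "x \<in> ell_inf \<Longrightarrow> y \<in> ell_inf \<Longrightarrow> a \<in> ell1 \<Longrightarrow>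
    pairing (\<lambda>n. x n + y n) a = pairing x a + pairing y a"
  unfolding pairing_def by (simp add: distrib_right infsum_add pairing_summable)

lemma pairing_scale_right: "pairing x (\<lambda>n. c * a n) = c * pairing x a"
  unfolding pairing_def by (simp add: mult.left_commute infsum_cmult_right')

lemma pairing_scale_left: "pairing (\<lambda>n. c * x n) a = c * pairing x a"
  unfolding pairing_def by (simp add: mult.assoc infsum_cmult_right')

lemma infsum_eq_single:
  fixes f :: "'a \<Rightarrow> 'b::{comm_monoid_add, t2_space}"
  assumes "\<And>k. k \<noteq> m \<Longrightarrow> f k = 0"
  shows "(\<Sum>\<^sub>\<infinity>k. f k) = f m"
proof -
  have "(\<Sum>\<^sub>\<infinity>k. f k) = (\<Sum>\<^sub>\<infinity>k\<in>{m}. f k)"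
    using assms by (intro infsum_cong_neutral) auto
  then show ?thesis by simp
qed

lemma pairing_unit_vec: "pairing x (unit_vec m) = x m"
  unfolding pairing_def by (subst infsum_eq_single[of m]) (auto simp: unit_vec_def)

lemma pairing_unit_vec_left: "pairing (unit_vec m) a = a m"
  unfolding pairing_def by (subst infsum_eq_single[of m]) (auto simp: unit_vec_def)

lemma unit_vec_ell_inf: "unit_vec m \<in> ell_inf"
  by (rule ell_infI[where K = 1]) (simp add: unit_vec_def)

lemma unit_vec_ell1: "unit_vec m \<in> ell1"
  unfolding ell1_def mem_Collect_eq
  by (rule finite_nonzero_values_imp_summable_on) (simp add: unit_vec_def)

lemma ell1_eqI: "(\<And>x. x \<in> ell_inf \<Longrightarrow> pairing x a = pairing x b) \<Longrightarrow> a = b"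
  using pairing_unit_vec_left unit_vec_ell_inf by (metis ext)

section \<open>Convolution and its adjoint action\<close>

lemma ell1_conv_unit_vec: "ell1_conv (unit_vec m) b = (\<lambda>n. b (n - m))"
  unfolding ell1_conv_def by (rule ext, subst infsum_eq_single[of m]) (auto simp: unit_vec_def)

lemma ell1_conv_unit_vecs: "ell1_conv (unit_vec m) (unit_vec n) = unit_vec (m + n)"
  unfolding ell1_conv_unit_vec by (auto simp: unit_vec_def fun_eq_iff)

lemma ell1_conv_commute: "ell1_conv a b = ell1_conv b a"
proof
  fix n
  have "bij_betw (\<lambda>k. n - k) UNIV (UNIV :: int set)"
    by (rule bij_betwI[where g = "\<lambda>k. n - k"]) auto
  from infsum_reindex_bij_betw[OF this, of "\<lambda>k. a k * b (n - k)"]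
  show "ell1_conv a b n = ell1_conv b a n"
    by (simp add: ell1_conv_def mult.commute)
qed

text \<open>The substitution taking (n, k) to (k, n - k) leads to the family
  \<open>s k * t m\<close>, whose absolute sum factors. Every interchange of sums for convolutions
  rests on this.\<close>

lemma ell1_conv_abs_summable:
  assumes s: "s \<in> ell1" and t: "t \<in> ell1"
  shows "(\<lambda>z. norm ((\<lambda>(n, k). s k * t (n - k)) z)) summable_on UNIV \<times> UNIV"
proof -
  have "(\<lambda>z. norm ((\<lambda>(k, m). s k * t m) z)) summable_on UNIV \<times> UNIV"
  proof -
    have "(\<lambda>k. norm (s k) * ell1_norm t) summable_on UNIV"
      using s by (intro summable_on_cmult_left) (simp add: ell1_def)
    moreover have "(\<lambda>m. norm (s k) * norm (t m)) summable_on UNIV" for k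
      using t by (intro summable_on_cmult_right) (simp add: ell1_def)
    ultimately show ?thesis
      unfolding Infinite_Sum.abs_summable_on_Sigma_iff
      by (simp add: norm_mult infsum_cmult_right' ell1_norm_def[symmetric] ell1_norm_nonneg)
  qed
  moreover have "bij_betw (\<lambda>(n, k). (k, n - k)) (UNIV \<times> UNIV) (UNIV \<times> (UNIV :: int set))"
    by (rule bij_betwI[where g = "\<lambda>(k, m). (k + m, k)"]) auto
  ultimately show ?thesis
    using summable_on_reindex_bij_betw[of "\<lambda>(n, k). (k, n - k)" "UNIV \<times> UNIV" "UNIV \<times> UNIV"
      "\<lambda>(k, m). norm (s k * t m)"]
    by (simp add: case_prod_unfold)
qed

lemma ell1_conv_ell1:
  assumes "s \<in> ell1" "t \<in> ell1"
  shows "ell1_conv s t \<in> ell1"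
proof -
  have s: "(\<lambda>k. norm (s k * t (n - k))) summable_on UNIV" for n
    using ell1_conv_abs_summable[OF assms] unfolding Infinite_Sum.abs_summable_on_Sigma_iff by auto
  have "(\<lambda>n. norm (\<Sum>\<^sub>\<infinity>k. norm (s k * t (n - k)))) summable_on UNIV"
    using ell1_conv_abs_summable[OF assms] unfolding Infinite_Sum.abs_summable_on_Sigma_iff by auto
  then have "(\<lambda>n. \<Sum>\<^sub>\<infinity>k. norm (s k * t (n - k))) summable_on UNIV"
    by (rule iffD2[OF summable_on_iff_abs_summable_on_real])
  then show ?thesis
    unfolding ell1_def ell1_conv_def mem_Collect_eq
    by (rule Infinite_Sum.abs_summable_on_comparison_test') (rule norm_infsum_bound[OF s])
qed

lemma ell1_act_ell_inf:
  assumes "t \<in> ell1" "x \<in> ell_inf"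
  shows "ell1_act t x \<in> ell_inf"
  unfolding ell1_act_def
  by (rule ell_infI) (rule norm_pairing_le[OF assms(1) norm_le_sup_norm[OF assms(2)]])

text \<open>Fubini and the substitution n = k + m. Convolution by \<open>t\<close> is thus the
  adjoint of \<open>ell1_act t\<close>, and the later algebra and continuity arguments work with
  this adjoint.\<close>

lemma pairing_conv:
  assumes x: "x \<in> ell_inf" and s: "s \<in> ell1" and t: "t \<in> ell1"
  shows "pairing x (ell1_conv s t) = pairing (ell1_act t x) s"
proof -
  have "(\<lambda>z. norm ((\<lambda>(n, k). x n * (s k * t (n - k))) z)) summable_on UNIV \<times> UNIV"
  proof (rule Infinite_Sum.abs_summable_on_comparison_test')
    show "(\<lambda>z. sup_norm UNIV x * norm ((\<lambda>(n, k). s k * t (n - k)) z)) summable_on UNIV \<times> UNIV"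
      by (rule summable_on_cmult_right[OF ell1_conv_abs_summable[OF s t]])
    show "norm ((\<lambda>(n, k). x n * (s k * t (n - k))) z) \<le>
        sup_norm UNIV x * norm ((\<lambda>(n, k). s k * t (n - k)) z)" for z
      using norm_le_sup_norm[OF x] by (auto simp: norm_mult case_prod_unfold intro!: mult_right_mono)
  qed
  then have sw: "(\<lambda>(n, k). x n * (s k * t (n - k))) summable_on UNIV \<times> UNIV"
    by (rule Infinite_Sum.abs_summable_summable)
  have "pairing x (ell1_conv s t) = (\<Sum>\<^sub>\<infinity>n. \<Sum>\<^sub>\<infinity>k. x n * (s k * t (n - k)))"
    by (simp add: pairing_def ell1_conv_def infsum_cmult_right')
  also have "\<dots> = (\<Sum>\<^sub>\<infinity>k. \<Sum>\<^sub>\<infinity>n. x n * (s k * t (n - k)))"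
    by (rule infsum_swap_banach[OF sw])
  also have "\<dots> = (\<Sum>\<^sub>\<infinity>k. \<Sum>\<^sub>\<infinity>m. s k * (x (k + m) * t m))"
  proof (rule infsum_cong)
    fix k
    have "bij_betw (\<lambda>m. k + m) UNIV (UNIV :: int set)"
      by (rule bij_betwI[where g = "\<lambda>n. n - k"]) auto
    from infsum_reindex_bij_betw[OF this, of "\<lambda>n. x n * (s k * t (n - k))"]
    show "(\<Sum>\<^sub>\<infinity>n. x n * (s k * t (n - k))) = (\<Sum>\<^sub>\<infinity>m. s k * (x (k + m) * t m))"
      by (simp add: mult.left_commute)
  qed
  also have "\<dots> = pairing (ell1_act t x) s"
    by (simp add: pairing_def ell1_act_def infsum_cmult_right' mult.commute)
  finally show ?thesis .
qed

lemma ell1_act_conv: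
  assumes "x \<in> ell_inf" "s \<in> ell1" "t \<in> ell1"
  shows "ell1_act (ell1_conv s t) x = ell1_act s (ell1_act t x)"
proof
  fix n
  have "ell1_act (ell1_conv s t) x n = pairing (ell1_act t (\<lambda>k. x (n + k))) s"
    unfolding ell1_act_def[of "ell1_conv s t"] by (rule pairing_conv[OF ell_inf_translate[OF assms(1)] assms(2,3)])
  also have "\<dots> = ell1_act s (ell1_act t x) n"
    by (simp add: ell1_act_def add.assoc)
  finally show "ell1_act (ell1_conv s t) x n = ell1_act s (ell1_act t x) n" .
qed

text \<open>Tested against bounded sequences, both sides reduce by adjointness and the module law
  \<open>ell1_act_conv\<close> to the same pairing with \<open>r\<close>, so no triple sum
  occurs.\<close>

lemma ell1_conv_assoc:
  assumes "r \<in> ell1" "s \<in> ell1" "t \<in> ell1"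
  shows "ell1_conv (ell1_conv r s) t = ell1_conv r (ell1_conv s t)"
  by (rule ell1_eqI) (simp add: assms pairing_conv ell1_act_conv ell1_act_ell_inf ell1_conv_ell1)

section \<open>The map \<open>iota\<close> and closed shift-invariant subspaces\<close>

lemma complex_linear_on_iota:
  assumes "F \<subseteq> ell_inf"
  shows "complex_linear_on ell1 (iota F)"
  using assms unfolding complex_linear_on_def iota_eq
  by (auto simp: fun_eq_iff pairing_add_right pairing_scale_right subset_iff)

lemma iota_dual_space:
  assumes F: "F \<subseteq> ell_inf" "complex_subspace F" and a: "a \<in> ell1"
  shows "iota F a \<in> dual_space UNIV F"
proof (rule dual_spaceI[where K = "ell1_norm a"])
  show "iota F a (\<lambda>i. x i + y i) = iota F a x + iota F a y" if "x \<in> F" "y \<in> F" for x y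
    using that F a complex_subspaceD(2)[OF F(2) that]
    by (simp add: iota_eq_pairing pairing_add_left subset_iff)
  show "iota F a (\<lambda>i. c * x i) = c * iota F a x" if "x \<in> F" for x c
    using that complex_subspaceD(3)[OF F(2) that] by (simp add: iota_eq_pairing pairing_scale_left)
  show "norm (iota F a x) \<le> ell1_norm a * sup_norm UNIV x" if "x \<in> F" for x
    using norm_pairing_le[OF a norm_le_sup_norm, of x] that F(1)
    by (auto simp: iota_eq_pairing mult.commute)
  show "iota F a x = 0" if "x \<notin> F" for x
    using that by (simp add: iota_def)
qed

lemma dual_norm_iota_le:
  assumes F: "F \<subseteq> ell_inf" "complex_subspace F" and a: "a \<in> ell1"
  shows "dual_norm UNIV F (iota F a) \<le> ell1_norm a"
proof (rule dual_norm_least[OF F(2) _ ell1_norm_nonneg])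
  show "norm (iota F a x) \<le> ell1_norm a * sup_norm UNIV x" if "x \<in> F" for x
    using norm_pairing_le[OF a norm_le_sup_norm, of x] that F(1)
    by (auto simp: iota_eq_pairing mult.commute)
qed simp

lemma closed_subspace_ell_infD:
  assumes "closed_subspace_ell_inf E"
  shows "E \<subseteq> ell_inf" "complex_subspace E"
    and "(\<And>\<epsilon>. 0 < \<epsilon> \<Longrightarrow> \<exists>y\<in>E. \<forall>n. norm (y n - x n) \<le> \<epsilon>) \<Longrightarrow> x \<in> E"
proof -
  show "E \<subseteq> ell_inf" "complex_subspace E" using assms by (auto simp: closed_subspace_ell_inf_def)
  assume approx: "\<And>\<epsilon>. 0 < \<epsilon> \<Longrightarrow> \<exists>y\<in>E. \<forall>n. norm (y n - x n) \<le> \<epsilon>"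
  \<comment> \<open>Closedness is defined by sequences; approximations within 1/(k+1) convert it
    into the \<epsilon>-form used below.\<close>
  have "\<forall>k. \<exists>y. y \<in> E \<and> (\<forall>n. norm (y n - x n) \<le> 1 / Suc k)"
    using approx[of "1 / Suc k" for k] by auto
  then obtain u where u: "\<And>k. u k \<in> E" "\<And>k n. norm (u k n - x n) \<le> 1 / Suc k" by metis
  have "uniform_limit UNIV u x sequentially"
    unfolding uniform_limit_sequentially_iff
  proof (intro allI impI)
    fix e :: real assume "0 < e"
    then obtain N where N: "1 / Suc N < e" using nat_approx_posE by auto
    have "dist (u n i) (x i) < e" if "n \<ge> N" for n i
    proof -
      have "1 / Suc n \<le> 1 / Suc N" using that by (simp add: frac_le)
      then show ?thesis using u(2)[of n i] N by (simp add: dist_norm)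
    qed
    then show "\<exists>N. \<forall>n\<ge>N. \<forall>i\<in>UNIV. dist (u n i) (x i) < e" by blast
  qed
  then show "x \<in> E" using assms u(1) unfolding closed_subspace_ell_inf_def by blast
qed

text \<open>Since \<open>E\<close> equals its shifted image, it is stable under the inverse shift
  too, so induction over the integers can run upwards and downwards from 0.\<close>

lemma shift_invariant_translate:
  assumes "shift ` E = E" "x \<in> E"
  shows "(\<lambda>k. x (k + n)) \<in> E"
proof -
  have right: "(\<lambda>k. y (k + 1)) \<in> E" if y: "y \<in> E" for y
  proof -
    have "y \<in> shift ` E" using y assms(1) by simp
    then obtain z where "z \<in> E" "y = shift z" by blast
    then show ?thesis by (simp add: shift_def)
  qed
  have left: "(\<lambda>k. y (k - 1)) \<in> E" if y: "y \<in> E" for y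
  proof -
    have "shift y \<in> shift ` E" using y by blast
    then show ?thesis using assms(1) by (simp add: shift_def)
  qed
  show ?thesis
  proof (induction n rule: int_induct[where k = 0])
    case base
    then show ?case using assms(2) by simp
  next
    case (step1 i)
    from right[OF step1(2)] show ?case by (simp add: algebra_simps)
  next
    case (step2 i)
    from left[OF step2(2)] show ?case by (simp add: algebra_simps)
  qed
qed

text \<open>\<open>ell1_act t x\<close> is a uniformly convergent combination of translates of
  \<open>x\<close>. Cutting \<open>t\<close> off to a finite set leaves a tail whose
  \<open>ell1\<close> norm controls the uniform error, and closedness of \<open>E\<close> does the
  rest.\<close>

lemma shift_invariant_act:
  assumes E: "closed_subspace_ell_inf E" and inv: "shift ` E = E" and x: "x \<in> E" and t: "t \<in> ell1"
  shows "ell1_act t x \<in> E"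
proof (rule closed_subspace_ell_infD(3)[OF E])
  fix \<epsilon> :: real assume "0 < \<epsilon>"
  note V = closed_subspace_ell_infD(2)[OF E]
  have xb: "x \<in> ell_inf" using closed_subspace_ell_infD(1)[OF E] x by blast
  \<comment> \<open>The summand 1 keeps \<open>K\<close> positive when \<open>x = 0\<close>, so that
    \<open>\<epsilon> / K\<close> is a legitimate tolerance for the tail.\<close>
  define K where "K = sup_norm UNIV x + 1"
  have K: "0 < K" "norm (x n) \<le> K" for n
    using sup_norm_ell_inf_nonneg[OF xb] norm_le_sup_norm[OF xb, of n] by (auto simp: K_def)
  have ts: "(\<lambda>n. norm (t n)) summable_on UNIV" using t by (simp add: ell1_def)
  obtain F where F: "finite F" "dist (\<Sum>n\<in>F. norm (t n)) (\<Sum>\<^sub>\<infinity>n. norm (t n)) \<le> \<epsilon> / K"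
    using infsum_finite_approximation[OF ts, of "\<epsilon> / K"] \<open>0 < \<epsilon>\<close> K(1) by auto
  define t' where "t' n = (if n \<in> F then 0 else t n)" for n
  have t': "t' \<in> ell1"
    unfolding ell1_def mem_Collect_eq
    by (rule Infinite_Sum.abs_summable_on_comparison_test'[OF ts]) (simp add: t'_def)
  have tail: "ell1_norm t' \<le> \<epsilon> / K"
  proof -
    have "(\<Sum>\<^sub>\<infinity>n. norm (t n)) = (\<Sum>\<^sub>\<infinity>n. (if n \<in> F then norm (t n) else 0) + norm (t' n))"
      by (rule infsum_cong) (simp add: t'_def)
    also have "\<dots> = (\<Sum>\<^sub>\<infinity>n. if n \<in> F then norm (t n) else 0) + ell1_norm t'"
      unfolding ell1_norm_def
    proof (rule infsum_add)
      show "(\<lambda>n. if n \<in> F then norm (t n) else 0) summable_on UNIV"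
        using F(1) by (intro finite_nonzero_values_imp_summable_on) (auto elim: finite_subset[rotated])
    qed (use t' in \<open>simp add: ell1_def\<close>)
    also have "(\<Sum>\<^sub>\<infinity>n. if n \<in> F then norm (t n) else 0) = (\<Sum>\<^sub>\<infinity>n\<in>F. norm (t n))"
      by (rule infsum_cong_neutral) auto
    finally show ?thesis using F by (simp add: dist_real_def)
  qed
  define y where "y n = (\<Sum>k\<in>F. t k * x (n + k))" for n
  have "(\<lambda>n. \<Sum>k\<in>F. t k * x (n + k)) \<in> E"
    using F(1)
  proof (induction F)
    case empty
    then show ?case using complex_subspaceD(1)[OF V] by simp
  next
    case (insert k F)
    have "(\<lambda>n. (\<Sum>k\<in>F. t k * x (n + k)) + t k * x (n + k)) \<in> E"
      by (rule complex_subspaceD(4)[OF V insert.IH shift_invariant_translate[OF inv x]])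
    then show ?case using insert.hyps by (simp add: add.commute)
  qed
  then have "y \<in> E" by (simp add: y_def[abs_def])
  moreover have "norm (y n - ell1_act t x n) \<le> \<epsilon>" for n
  proof -
    let ?s = "\<lambda>k. if k \<in> F then t k else 0"
    have s: "?s \<in> ell1"
      unfolding ell1_def mem_Collect_eq
      by (rule Infinite_Sum.abs_summable_on_comparison_test'[OF ts]) simp
    have "ell1_act t x n = pairing (\<lambda>k. x (n + k)) (\<lambda>k. ?s k + t' k)"
      unfolding ell1_act_def by (rule arg_cong[where f = "pairing _"]) (auto simp: t'_def)
    also have "\<dots> = pairing (\<lambda>k. x (n + k)) ?s + pairing (\<lambda>k. x (n + k)) t'"
      by (rule pairing_add_right[OF ell_inf_translate[OF xb] s t'])
    also have "pairing (\<lambda>k. x (n + k)) ?s = (\<Sum>\<^sub>\<infinity>k\<in>F. t k * x (n + k))"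
      unfolding pairing_def by (rule infsum_cong_neutral) auto
    finally have "ell1_act t x n = y n + pairing (\<lambda>k. x (n + k)) t'"
      using F(1) by (simp add: y_def)
    then have "norm (y n - ell1_act t x n) = norm (pairing (\<lambda>k. x (n + k)) t')" by simp
    also have "\<dots> \<le> K * ell1_norm t'"
      by (rule norm_pairing_le[OF t' K(2)])
    also have "\<dots> \<le> K * (\<epsilon> / K)" using tail K(1) by (intro mult_left_mono) auto
    finally show ?thesis using K(1) by simp
  qed
  ultimately show "\<exists>y\<in>E. \<forall>n. norm (y n - ell1_act t x n) \<le> \<epsilon>" by blast
qed

section \<open>The predual defined by a projection\<close>

lemma complex_subspace_cont_funs: "complex_subspace (cont_funs S)"
proof -
  have "continuous_map S euclidean (\<lambda>s. c * f s)" if "continuous_map S euclidean f"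
    for c and f :: "'a \<Rightarrow> complex"
  proof -
    have "continuous_map euclidean euclidean ((*) c)"
      unfolding continuous_map_iff_continuous2 by (intro continuous_intros)
    from continuous_map_compose[OF that this] show ?thesis by (simp add: o_def)
  qed
  then show ?thesis
    by (auto simp: complex_subspace_def cont_funs_def intro: continuous_map_add)
qed

lemma bounded_cont_funs:
  assumes "compact_space S" "f \<in> cont_funs S"
  shows "bounded (f ` topspace S)"
proof -
  have "compactin euclidean (f ` topspace S)"
    using image_compactin[of S "topspace S" euclidean f] assms
    by (simp add: compact_space_def cont_funs_def)
  then show ?thesis by (simp add: compact_imp_bounded)
qed

lemma cont_funs_cong: "f \<in> cont_funs S \<Longrightarrow> (\<And>s. s \<in> topspace S \<Longrightarrow> f s = g s) \<Longrightarrow> g \<in> cont_funs S"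
  unfolding cont_funs_def using continuous_map_eq[of S euclidean f g] by simp

lemma semigroup_compactificationD:
  assumes "semigroup_compactification S add j"
  shows "compact_space S" "Hausdorff_space S" "j n \<in> topspace S" "topspace S \<noteq> {}"
    and "inj j" "j (m + n) = add (j m) (j n)" "S closure_of range j = topspace S"
    and "t \<in> topspace S \<Longrightarrow> continuous_map S S (\<lambda>s. add s t)"
    and "t \<in> topspace S \<Longrightarrow> continuous_map S S (\<lambda>s. add t s)"
  using assms by (auto simp: semigroup_compactification_def semitopological_semigroup_def)

text \<open>Density of the integers: the preimage of a closed disc is closed and contains
  \<open>range j\<close>. It makes restriction to the integers isometric.\<close>

lemma cont_funs_norm_le:
  assumes S: "semigroup_compactification S add j" and f: "f \<in> cont_funs S"
    and le: "\<And>n. norm (f (j n)) \<le> K" and s: "s \<in> topspace S"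
  shows "norm (f s) \<le> K"
proof (rule forall_in_closure_of[of s S "range j"])
  show "s \<in> S closure_of range j" using semigroup_compactificationD(7)[OF S] s by simp
  have "closedin S {s \<in> topspace S. f s \<in> cball 0 K}"
    using f by (intro closedin_continuous_map_preimage) (auto simp: cont_funs_def)
  then show "closedin S {s \<in> topspace S. norm (f s) \<le> K}" by simp
qed (use le in auto)

lemma cont_funs_comp_ell_inf:
  assumes S: "semigroup_compactification S add j" and f: "f \<in> cont_funs S"
  shows "f \<circ> j \<in> ell_inf"
proof -
  have "norm ((f \<circ> j) n) \<le> sup_norm (topspace S) f" for n
    using sup_norm_upper[OF bounded_cont_funs[OF _ f]] semigroup_compactificationD[OF S] by simp
  then show ?thesis by (rule ell_infI)
qed

lemma sup_norm_comp:
  assumes S: "semigroup_compactification S add j" and f: "f \<in> cont_funs S"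
  shows "sup_norm UNIV (f \<circ> j) = sup_norm (topspace S) f"
proof (rule antisym)
  show "sup_norm UNIV (f \<circ> j) \<le> sup_norm (topspace S) f"
    using sup_norm_upper[OF bounded_cont_funs[OF _ f]] semigroup_compactificationD[OF S]
    by (intro sup_norm_least) auto
  show "sup_norm (topspace S) f \<le> sup_norm UNIV (f \<circ> j)"
    using cont_funs_norm_le[OF S f] norm_le_sup_norm[OF cont_funs_comp_ell_inf[OF S f]]
      semigroup_compactificationD(4)[OF S]
    by (intro sup_norm_least) auto
qed

text \<open>A sequence that converges uniformly on the integers is uniformly Cauchy on all of
  \<open>S\<close> by density, so its limit extends continuously to \<open>S\<close>.\<close>

lemma cont_funs_uniform_limit:
  assumes S: "semigroup_compactification S add j" and f: "\<And>k. f k \<in> cont_funs S"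
    and lim: "uniform_limit UNIV (\<lambda>k. f k \<circ> j) x sequentially"
  obtains g where "g \<in> cont_funs S" "g \<circ> j = x"
    "\<And>\<epsilon>. 0 < \<epsilon> \<Longrightarrow> \<exists>k. \<forall>s\<in>topspace S. norm (f k s - g s) \<le> \<epsilon>"
proof -
  have mc: "Met_TC.mcomplete TYPE(complex)"
    by (simp add: complete_UNIV)
  obtain g where g: "continuous_map S euclidean g"
    and unif: "\<And>\<epsilon>. 0 < \<epsilon> \<Longrightarrow> \<forall>\<^sub>F k in sequentially. \<forall>s\<in>topspace S. dist (f k s) (g s) < \<epsilon>"
  proof (rule Met_TC.continuous_map_uniformly_Cauchy_limit[of S f, OF mc])
    show "\<forall>\<^sub>F k in sequentially. continuous_map S Met_TC.mtopology (f k)"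
      using f by (simp add: cont_funs_def)
    fix \<epsilon> :: real assume "0 < \<epsilon>"
    then have "\<forall>\<^sub>F k in sequentially. \<forall>n\<in>UNIV. dist ((f k \<circ> j) n) (x n) < \<epsilon> / 4"
      by (intro uniform_limitD[OF lim]) simp
    then obtain N where N: "\<And>k n. N \<le> k \<Longrightarrow> dist (f k (j n)) (x n) < \<epsilon> / 4"
      by (auto simp: eventually_sequentially)
    have "dist (f k s) (f l s) < \<epsilon>" if "N \<le> k" "N \<le> l" "s \<in> topspace S" for k l s
    proof -
      \<comment> \<open>Passing to the closure preserves weak inequalities only; aiming at
        \<open>\<epsilon> / 2\<close> leaves room for the strict bound.\<close>
      have "norm (f k (j n) - f l (j n)) \<le> \<epsilon> / 2" for n
        using dist_triangle_half_l[of "f k (j n)" "x n" "\<epsilon> / 2" "f l (j n)"] N[OF that(1), of n] N[OF that(2), of n]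
        by (simp add: dist_norm)
      then have "norm (f k s - f l s) \<le> \<epsilon> / 2"
        by (rule cont_funs_norm_le[OF S complex_subspaceD(5)[OF complex_subspace_cont_funs f f] _ that(3)])
      then show ?thesis using \<open>0 < \<epsilon>\<close> by (simp add: dist_norm)
    qed
    then show "\<exists>N. \<forall>k l s. N \<le> k \<longrightarrow> N \<le> l \<longrightarrow> s \<in> topspace S \<longrightarrow> dist (f k s) (f l s) < \<epsilon>"
      by blast
  qed (simp_all add: that)
  have "(g \<circ> j) n = x n" for n
  proof -
    have "(\<lambda>k. f k (j n)) \<longlonglongrightarrow> g (j n)"
    proof (rule tendstoI)
      fix e :: real assume "0 < e"
      from unif[OF this] show "\<forall>\<^sub>F k in sequentially. dist (f k (j n)) (g (j n)) < e"
        by (rule eventually_mono) (use semigroup_compactificationD(3)[OF S, of n] in simp)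
    qed
    moreover have "(\<lambda>k. f k (j n)) \<longlonglongrightarrow> x n"
      using tendsto_uniform_limitI[OF lim, of n] by simp
    ultimately show ?thesis using LIMSEQ_unique by auto
  qed
  moreover have "\<exists>k. \<forall>s\<in>topspace S. norm (f k s - g s) \<le> \<epsilon>" if "0 < \<epsilon>" for \<epsilon>
    using eventually_happens[OF unif[OF that]] by (auto simp: dist_norm intro: less_imp_le)
  ultimately show thesis using g by (intro that[of g]) (auto simp: cont_funs_def)
qed

lemma point_mass_meas:
  assumes "compact_space S" and s: "s \<in> topspace S"
  shows "point_mass S s \<in> meas S"
  unfolding meas_def
proof (rule dual_spaceI[where K = 1])
  note V = complex_subspace_cont_funs[of S]
  show "point_mass S s (\<lambda>i. f i + g i) = point_mass S s f + point_mass S s g"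
    if "f \<in> cont_funs S" "g \<in> cont_funs S" for f g
    using complex_subspaceD(2)[OF V that] that by (simp add: point_mass_def)
  show "point_mass S s (\<lambda>i. c * f i) = c * point_mass S s f" if "f \<in> cont_funs S" for c f
    using complex_subspaceD(3)[OF V that, of c] that by (simp add: point_mass_def)
  show "norm (point_mass S s f) \<le> 1 * sup_norm (topspace S) f" if "f \<in> cont_funs S" for f
    using sup_norm_upper[OF bounded_cont_funs[OF assms(1) that] s] that by (simp add: point_mass_def)
qed (simp add: point_mass_def)

lemma ell1_to_meas_apply: "f \<in> cont_funs S \<Longrightarrow> ell1_to_meas S j a f = pairing (f \<circ> j) a"
  by (simp add: ell1_to_meas_def pairing_def mult.commute)

lemma ell1_to_meas_meas:
  assumes S: "semigroup_compactification S add j" and a: "a \<in> ell1"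
  shows "ell1_to_meas S j a \<in> meas S"
  unfolding meas_def
proof (rule dual_spaceI[where K = "ell1_norm a"])
  note V = complex_subspace_cont_funs[of S]
  show "ell1_to_meas S j a (\<lambda>i. f i + g i) = ell1_to_meas S j a f + ell1_to_meas S j a g"
    if "f \<in> cont_funs S" "g \<in> cont_funs S" for f g
    using complex_subspaceD(2)[OF V that] that a
      pairing_add_left[OF cont_funs_comp_ell_inf[OF S that(1)] cont_funs_comp_ell_inf[OF S that(2)] a]
    by (simp add: ell1_to_meas_apply o_def)
  show "ell1_to_meas S j a (\<lambda>i. c * f i) = c * ell1_to_meas S j a f" if "f \<in> cont_funs S" for c f
    using complex_subspaceD(3)[OF V that] that pairing_scale_left[of c "f \<circ> j" a]
    by (simp add: ell1_to_meas_apply o_def)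
  show "norm (ell1_to_meas S j a f) \<le> ell1_norm a * sup_norm (topspace S) f" if "f \<in> cont_funs S" for f
    using norm_pairing_le[where x = "f \<circ> j", OF a norm_le_sup_norm[OF cont_funs_comp_ell_inf[OF S that]]]
    by (simp add: ell1_to_meas_apply[OF that] sup_norm_comp[OF S that] mult.commute)
  show "ell1_to_meas S j a f = 0" if "f \<notin> cont_funs S" for f
    using that by (simp add: ell1_to_meas_def)
qed

text \<open>The inner integral against a point mass evaluates \<open>f (add s t)\<close>. For
  \<open>t\<close> off the carrier the section in \<open>s\<close> may fail to be continuous and
  \<open>point_mass\<close> then returns 0, so the two integrands are identified on the carrier
  only.\<close>

lemma meas_conv_point_mass:
  assumes S: "semigroup_compactification S add j" and s: "s \<in> topspace S" and \<Psi>: "\<Psi> \<in> meas S"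
    and f: "f \<in> cont_funs S"
  shows "(\<lambda>t. f (add s t)) \<in> cont_funs S"
    and "meas_conv S add (point_mass S s) \<Psi> f = \<Psi> (\<lambda>t. f (add s t))"
proof -
  show left: "(\<lambda>t. f (add s t)) \<in> cont_funs S"
    using continuous_map_compose[OF semigroup_compactificationD(9)[OF S s], of euclidean f] f
    by (simp add: cont_funs_def o_def)
  have eq: "f (add s t) = point_mass S s (\<lambda>s. f (add s t))" if "t \<in> topspace S" for t
    using continuous_map_compose[OF semigroup_compactificationD(8)[OF S that], of euclidean f] f
    by (simp add: cont_funs_def o_def point_mass_def)
  have "\<Psi> (\<lambda>t. point_mass S s (\<lambda>s. f (add s t))) = \<Psi> (\<lambda>t. f (add s t))"
    using eq
    by (intro dual_space_cong[OF \<Psi>[unfolded meas_def] complex_subspace_cont_funs]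
        semigroup_compactificationD(4)[OF S] left cont_funs_cong[OF left]) auto
  then show "meas_conv S add (point_mass S s) \<Psi> f = \<Psi> (\<lambda>t. f (add s t))"
    using f by (simp add: meas_conv_def)
qed

lemma meas_conv_point_mass_meas:
  assumes S: "semigroup_compactification S add j" and s: "s \<in> topspace S" and \<Psi>: "\<Psi> \<in> meas S"
  shows "meas_conv S add (point_mass S s) \<Psi> \<in> meas S"
proof -
  note V = complex_subspace_cont_funs[of S]
  note pm = meas_conv_point_mass[OF S s \<Psi>]
  note \<Psi>' = \<Psi>[unfolded meas_def]
  obtain K where K: "\<And>f. f \<in> cont_funs S \<Longrightarrow> norm (\<Psi> f) \<le> K * sup_norm (topspace S) f"
    using dual_spaceD(4)[OF \<Psi>'] by blast
  show ?thesis
    unfolding meas_def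
  proof (rule dual_spaceI[where K = "\<bar>K\<bar>"])
    show "meas_conv S add (point_mass S s) \<Psi> (\<lambda>i. f i + g i) =
        meas_conv S add (point_mass S s) \<Psi> f + meas_conv S add (point_mass S s) \<Psi> g"
      if "f \<in> cont_funs S" "g \<in> cont_funs S" for f g
      using complex_subspaceD(2)[OF V that] that dual_spaceD(1)[OF \<Psi>' pm(1)[OF that(1)] pm(1)[OF that(2)]]
      by (simp add: pm(2))
    show "meas_conv S add (point_mass S s) \<Psi> (\<lambda>i. c * f i) = c * meas_conv S add (point_mass S s) \<Psi> f"
      if "f \<in> cont_funs S" for c f
      using complex_subspaceD(3)[OF V that] that dual_spaceD(2)[OF \<Psi>' pm(1)[OF that]]
      by (simp add: pm(2))
    show "norm (meas_conv S add (point_mass S s) \<Psi> f) \<le> \<bar>K\<bar> * sup_norm (topspace S) f"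
      if f: "f \<in> cont_funs S" for f
    proof -
      have bdd: "bounded (f ` topspace S)"
        using bounded_cont_funs f semigroup_compactificationD(1)[OF S] by blast
      have "add s t \<in> topspace S" if "t \<in> topspace S" for t
        using semigroup_compactificationD(9)[OF S s] that by (auto simp: continuous_map_def)
      then have "sup_norm (topspace S) (\<lambda>t. f (add s t)) \<le> sup_norm (topspace S) f"
        using semigroup_compactificationD(4)[OF S] sup_norm_upper[OF bdd] by (intro sup_norm_least) auto
      moreover have "0 \<le> sup_norm (topspace S) (\<lambda>t. f (add s t))"
        using sup_norm_nonneg[OF semigroup_compactificationD(4)[OF S]
          bounded_cont_funs[OF semigroup_compactificationD(1)[OF S] pm(1)[OF f]]] .
      ultimately have "K * sup_norm (topspace S) (\<lambda>t. f (add s t)) \<le> \<bar>K\<bar> * sup_norm (topspace S) f"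
        by (intro mult_mono) auto
      then show ?thesis using K[OF pm(1)[OF f]] by (simp add: pm(2)[OF f])
    qed
    show "meas_conv S add (point_mass S s) \<Psi> f = 0" if "f \<notin> cont_funs S" for f
      using that by (simp add: meas_conv_def)
  qed
qed

section \<open>The kernel of the projection and its pre-annihilator\<close>

lemma bounded_projectionD:
  assumes "bounded_projection S j \<Theta>"
  shows "\<Phi> \<in> meas S \<Longrightarrow> \<Theta> \<Phi> \<in> ell1"
    and "\<Phi> \<in> meas S \<Longrightarrow> \<Psi> \<in> meas S \<Longrightarrow> \<Theta> (\<lambda>f. \<Phi> f + \<Psi> f) = (\<lambda>n. \<Theta> \<Phi> n + \<Theta> \<Psi> n)"
    and "\<Phi> \<in> meas S \<Longrightarrow> \<Theta> (\<lambda>f. c * \<Phi> f) = (\<lambda>n. c * \<Theta> \<Phi> n)"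
    and "a \<in> ell1 \<Longrightarrow> \<Theta> (ell1_to_meas S j a) = a"
    and "\<exists>K. \<forall>\<Phi>\<in>meas S. ell1_norm (\<Theta> \<Phi>) \<le> K * meas_norm S \<Phi>"
  using assms by (auto simp: bounded_projection_def complex_linear_on_def)

lemma complex_subspace_meas_ker:
  assumes \<Theta>: "bounded_projection S j \<Theta>"
  shows "complex_subspace (meas_ker S \<Theta>)"
proof -
  note M = complex_subspaceD[OF complex_subspace_dual_space[of "topspace S" "cont_funs S"], folded meas_def]
  have "\<Theta> (\<lambda>_. 0) = (\<lambda>_. 0)"
    using bounded_projectionD(3)[OF \<Theta> M(1), of 0] by simp
  then show ?thesis
    using M(1-3) bounded_projectionD(2,3)[OF \<Theta>] by (auto simp: complex_subspace_def meas_ker_def)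
qed

lemma pre_annihilatorD:
  assumes "f \<in> pre_annihilator S N"
  shows "f \<in> cont_funs S" "\<Psi> \<in> N \<Longrightarrow> \<Psi> f = 0"
  using assms unfolding pre_annihilator_def by blast+

lemma complex_subspace_pre_annihilator:
  assumes "N \<subseteq> meas S"
  shows "complex_subspace (pre_annihilator S N)"
  unfolding complex_subspace_def
proof (intro conjI ballI allI)
  note V = complex_subspaceD[OF complex_subspace_cont_funs[of S]]
  have \<Psi>: "\<Psi> \<in> dual_space (topspace S) (cont_funs S)" if "\<Psi> \<in> N" for \<Psi>
    using that assms by (auto simp: meas_def)
  show "(\<lambda>_. 0) \<in> pre_annihilator S N"
    unfolding pre_annihilator_def mem_Collect_eq
    using V(1) dual_spaceD(2)[OF \<Psi> V(1), of _ 0] by auto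
  show "(\<lambda>i. f i + g i) \<in> pre_annihilator S N"
    if f: "f \<in> pre_annihilator S N" and g: "g \<in> pre_annihilator S N" for f g
  proof -
    have fg: "f \<in> cont_funs S" "g \<in> cont_funs S" using f g by (auto simp: pre_annihilator_def)
    have "\<Psi> (\<lambda>i. f i + g i) = 0" if "\<Psi> \<in> N" for \<Psi>
      using dual_spaceD(1)[OF \<Psi>[OF that] fg] pre_annihilatorD(2)[OF f that] pre_annihilatorD(2)[OF g that]
      by simp
    then show ?thesis using V(2)[OF fg] by (simp add: pre_annihilator_def)
  qed
  show "(\<lambda>i. c * f i) \<in> pre_annihilator S N" if f: "f \<in> pre_annihilator S N" for c f
  proof -
    have fC: "f \<in> cont_funs S" using f by (simp add: pre_annihilator_def)
    have "\<Psi> (\<lambda>i. c * f i) = 0" if "\<Psi> \<in> N" for \<Psi>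
      using dual_spaceD(2)[OF \<Psi>[OF that] fC] pre_annihilatorD(2)[OF f that] by simp
    then show ?thesis using V(3)[OF fC] by (simp add: pre_annihilator_def)
  qed
qed

text \<open>Uniform limits taken on the integers lift to uniform limits in C(S), where every bounded
  functional is continuous; the elements of \<open>N\<close> therefore also vanish at the
  limit.\<close>

lemma closed_subspace_restrict_pre_annihilator:
  assumes S: "semigroup_compactification S add j" and N: "N \<subseteq> meas S"
  shows "closed_subspace_ell_inf (restrict_to_int j (pre_annihilator S N))"
  unfolding closed_subspace_ell_inf_def
proof (intro conjI allI impI)
  let ?P = "pre_annihilator S N"
  note V = complex_subspace_cont_funs[of S]
  note P = complex_subspaceD[OF complex_subspace_pre_annihilator[OF N]]
  have PC: "f \<in> cont_funs S" if "f \<in> ?P" for f using that by (simp add: pre_annihilator_def)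
  show "restrict_to_int j ?P \<subseteq> ell_inf"
    using cont_funs_comp_ell_inf[OF S PC] by (auto simp: restrict_to_int_def)
  show "complex_subspace (restrict_to_int j ?P)"
    unfolding complex_subspace_def
  proof (intro conjI ballI allI)
    have "(\<lambda>_. 0) \<circ> j \<in> restrict_to_int j ?P"
      unfolding restrict_to_int_def by (rule imageI[OF P(1)])
    then show "(\<lambda>_. 0) \<in> restrict_to_int j ?P" by (simp add: o_def)
  next
    fix x y assume "x \<in> restrict_to_int j ?P" "y \<in> restrict_to_int j ?P"
    then obtain f g where fg: "f \<in> ?P" "x = f \<circ> j" "g \<in> ?P" "y = g \<circ> j"
      by (auto simp: restrict_to_int_def)
    have "(\<lambda>i. f i + g i) \<circ> j \<in> restrict_to_int j ?P"
      unfolding restrict_to_int_def by (rule imageI[OF P(2)[OF fg(1,3)]])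
    then show "(\<lambda>i. x i + y i) \<in> restrict_to_int j ?P" by (simp add: fg o_def)
  next
    fix c x assume "x \<in> restrict_to_int j ?P"
    then obtain f where f: "f \<in> ?P" "x = f \<circ> j" by (auto simp: restrict_to_int_def)
    have "(\<lambda>i. c * f i) \<circ> j \<in> restrict_to_int j ?P"
      unfolding restrict_to_int_def by (rule imageI[OF P(3)[OF f(1)]])
    then show "(\<lambda>i. c * x i) \<in> restrict_to_int j ?P" by (simp add: f o_def)
  qed
  fix u x assume u: "(\<forall>k. u k \<in> restrict_to_int j ?P) \<and> uniform_limit UNIV u x sequentially"
  then have "\<forall>k. \<exists>f. f \<in> ?P \<and> u k = f \<circ> j" by (auto simp: restrict_to_int_def)
  then obtain f where f: "\<And>k. f k \<in> ?P" "u = (\<lambda>k. f k \<circ> j)" by metis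
  obtain g where g: "g \<in> cont_funs S" "g \<circ> j = x"
    and unif: "\<And>\<epsilon>. 0 < \<epsilon> \<Longrightarrow> \<exists>k. \<forall>s\<in>topspace S. norm (f k s - g s) \<le> \<epsilon>"
  proof (rule cont_funs_uniform_limit[OF S PC[OF f(1)]])
    show "uniform_limit UNIV (\<lambda>k. f k \<circ> j) x sequentially" using u f(2) by simp
  qed (rule that)
  have "\<Psi> g = 0" if "\<Psi> \<in> N" for \<Psi>
  proof (rule ccontr)
    assume "\<Psi> g \<noteq> 0"
    have \<Psi>: "\<Psi> \<in> dual_space (topspace S) (cont_funs S)" using that N by (auto simp: meas_def)
    obtain K where K: "\<And>f. f \<in> cont_funs S \<Longrightarrow> norm (\<Psi> f) \<le> K * sup_norm (topspace S) f"
      using dual_spaceD(4)[OF \<Psi>] by blast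
    \<comment> \<open>A positive bound for \<Psi>. With the tolerance
      \<open>norm (\<Psi> g) / (2 * L)\<close> the value at \<open>g\<close> would be at most half
      of itself.\<close>
    define L where "L = \<bar>K\<bar> + 1"
    obtain k where k: "\<And>s. s \<in> topspace S \<Longrightarrow> norm (f k s - g s) \<le> norm (\<Psi> g) / (2 * L)"
      using unif[of "norm (\<Psi> g) / (2 * L)"] \<open>\<Psi> g \<noteq> 0\<close> by (auto simp: L_def)
    have d: "(\<lambda>s. f k s - g s) \<in> cont_funs S" by (rule complex_subspaceD(5)[OF V PC[OF f(1)] g(1)])
    have "norm (\<Psi> g) = norm (\<Psi> (\<lambda>s. f k s - g s))"
      using dual_space_comb(2)[OF \<Psi> V PC[OF f(1)] g(1), of k] pre_annihilatorD(2)[OF f(1) that, of k]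
      by simp
    also have "\<dots> \<le> L * sup_norm (topspace S) (\<lambda>s. f k s - g s)"
      using K[OF d] sup_norm_nonneg[OF semigroup_compactificationD(4)[OF S]
          bounded_cont_funs[OF semigroup_compactificationD(1)[OF S] d]]
      by (elim order_trans) (auto simp: L_def intro: mult_right_mono)
    also have "\<dots> \<le> L * (norm (\<Psi> g) / (2 * L))"
      using k semigroup_compactificationD(4)[OF S] by (intro mult_left_mono sup_norm_least) (auto simp: L_def)
    also have "\<dots> = norm (\<Psi> g) / 2" by (simp add: L_def field_simps)
    finally show False using \<open>\<Psi> g \<noteq> 0\<close> by simp
  qed
  then have "g \<in> ?P" using g(1) by (simp add: pre_annihilator_def)
  then show "x \<in> restrict_to_int j ?P" using g(2) by (auto simp: restrict_to_int_def)
qed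

text \<open>Translating \<open>f\<close> by an integer is adjoint to convolving with its point mass,
  and \<Theta> sends that convolution to a product with the zero sequence. Translations by -1 and by
  1 give the two inclusions.\<close>

lemma shift_restrict_pre_annihilator:
  assumes S: "semigroup_compactification S add j" and \<Theta>: "conv_homomorphism S add \<Theta>"
  shows "shift ` restrict_to_int j (pre_annihilator S (meas_ker S \<Theta>)) =
    restrict_to_int j (pre_annihilator S (meas_ker S \<Theta>))"
proof -
  let ?P = "pre_annihilator S (meas_ker S \<Theta>)"
  note D = semigroup_compactificationD[OF S]
  have trans: "(\<lambda>t. f (add (j m) t)) \<in> ?P" if f: "f \<in> ?P" for f m
  proof -
    have fC: "f \<in> cont_funs S" using f by (simp add: pre_annihilator_def)
    have "\<Psi> (\<lambda>t. f (add (j m) t)) = 0" if "\<Psi> \<in> meas_ker S \<Theta>" for \<Psi>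
    proof -
      have \<Psi>: "\<Psi> \<in> meas S" "\<Theta> \<Psi> = (\<lambda>_. 0)" using that by (auto simp: meas_ker_def)
      have "\<Theta> (meas_conv S add (point_mass S (j m)) \<Psi>) = (\<lambda>_. 0)"
        using \<Theta> point_mass_meas[OF D(1,3)] \<Psi> by (simp add: conv_homomorphism_def ell1_conv_def)
      then have "meas_conv S add (point_mass S (j m)) \<Psi> \<in> meas_ker S \<Theta>"
        using meas_conv_point_mass_meas[OF S D(3) \<Psi>(1)] by (simp add: meas_ker_def)
      then show ?thesis
        using f meas_conv_point_mass(2)[OF S D(3) \<Psi>(1) fC, of m] by (auto simp: pre_annihilator_def)
    qed
    then show ?thesis
      using meas_conv_point_mass(1)[OF S D(3) point_mass_meas[OF D(1,3)] fC]
      by (simp add: pre_annihilator_def)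
  qed
  have tr: "(\<lambda>n. x (m + n)) \<in> restrict_to_int j ?P" if "x \<in> restrict_to_int j ?P" for x m
  proof -
    obtain f where f: "f \<in> ?P" "x = f \<circ> j" using \<open>x \<in> restrict_to_int j ?P\<close> by (auto simp: restrict_to_int_def)
    have "(\<lambda>t. f (add (j m) t)) \<circ> j \<in> restrict_to_int j ?P"
      unfolding restrict_to_int_def by (rule imageI[OF trans[OF f(1)]])
    then show ?thesis by (simp add: f(2) o_def D(6))
  qed
  show ?thesis
  proof (intro equalityI subsetI)
    fix y assume "y \<in> shift ` restrict_to_int j ?P"
    then obtain x where "x \<in> restrict_to_int j ?P" "y = shift x" by blast
    with tr[of x "- 1"] show "y \<in> restrict_to_int j ?P" by (simp add: shift_def)
  next
    fix x assume "x \<in> restrict_to_int j ?P"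
    moreover have "x = shift (\<lambda>n. x (1 + n))" by (simp add: shift_def)
    ultimately show "x \<in> shift ` restrict_to_int j ?P" using tr[of x 1] by blast
  qed
qed

lemma shift_invariant_predual_pre_annihilator:
  assumes S: "semigroup_compactification S add j"
    and \<Theta>: "bounded_projection S j \<Theta>" and hom: "conv_homomorphism S add \<Theta>"
    and closed: "weak_star_closed S (meas_ker S \<Theta>)"
  shows "shift_invariant_predual (restrict_to_int j (pre_annihilator S (meas_ker S \<Theta>)))"
proof -
  let ?N = "meas_ker S \<Theta>"
  let ?P = "pre_annihilator S ?N"
  let ?F = "restrict_to_int j ?P"
  let ?A = "topspace S" and ?V = "cont_funs S"
  note D = semigroup_compactificationD[OF S]
  note V = complex_subspace_cont_funs[of S]
  note bdd = bounded_cont_funs[OF D(1)]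
  note M = complex_subspaceD[OF complex_subspace_dual_space[of ?A ?V], folded meas_def]
  have NM: "?N \<subseteq> meas S" by (auto simp: meas_ker_def)
  have N: "complex_subspace ?N" by (rule complex_subspace_meas_ker[OF \<Theta>])
  have P: "complex_subspace ?P" by (rule complex_subspace_pre_annihilator[OF NM])
  have FC: "closed_subspace_ell_inf ?F" by (rule closed_subspace_restrict_pre_annihilator[OF S NM])
  then have F: "?F \<subseteq> ell_inf" "complex_subspace ?F" by (auto dest: closed_subspace_ell_infD)
  have PC: "f \<in> ?V" if "f \<in> ?P" for f by (rule pre_annihilatorD(1)[OF that])
  have PF: "f \<circ> j \<in> ?F" if "f \<in> ?P" for f using that by (simp add: restrict_to_int_def)
  \<comment> \<open>The only use of weak-star closedness: a separating function for a measure
    outside the kernel would itself be in the pre-annihilator.\<close>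
  have bipolar: "\<Psi> \<in> ?N" if \<Psi>: "\<Psi> \<in> meas S" "\<And>f. f \<in> ?P \<Longrightarrow> \<Psi> f = 0" for \<Psi>
  proof (rule ccontr)
    assume "\<Psi> \<notin> ?N"
    show False
    proof (rule weak_star_separation[OF V N closed[unfolded weak_star_closed_def] \<Psi>(1)[unfolded meas_def] \<open>\<Psi> \<notin> ?N\<close>])
      fix f assume f: "f \<in> ?V" "\<And>\<Phi>. \<Phi> \<in> ?N \<Longrightarrow> \<Phi> f = 0" "\<Psi> f \<noteq> 0"
      then have "f \<in> ?P" by (simp add: pre_annihilator_def)
      then show False using f(3) \<Psi>(2) by blast
    qed
  qed
  \<comment> \<open>\<Psi> minus the measure carried by the sequence \<open>\<Theta> \<Psi>\<close>
    lies in the kernel because \<Theta> fixes \<open>ell1\<close>, and \<open>f\<close> annihilates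
    the kernel.\<close>
  have eval: "\<Psi> f = pairing (f \<circ> j) (\<Theta> \<Psi>)" if \<Psi>: "\<Psi> \<in> meas S" and f: "f \<in> ?P" for \<Psi> f
  proof -
    let ?\<Phi> = "ell1_to_meas S j (\<Theta> \<Psi>)"
    note a = bounded_projectionD(1)[OF \<Theta> \<Psi>]
    have \<Phi>: "?\<Phi> \<in> meas S" by (rule ell1_to_meas_meas[OF S a])
    have "\<Theta> (\<lambda>g. \<Psi> g + - 1 * ?\<Phi> g) = (\<lambda>n. \<Theta> \<Psi> n + - 1 * \<Theta> ?\<Phi> n)"
      using bounded_projectionD(2)[OF \<Theta> \<Psi> M(3)[OF \<Phi>], of "- 1"] bounded_projectionD(3)[OF \<Theta> \<Phi>, of "- 1"]
      by simp
    then have "(\<lambda>g. \<Psi> g + - 1 * ?\<Phi> g) \<in> ?N"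
      using M(4)[OF \<Psi> \<Phi>, of "- 1"] bounded_projectionD(4)[OF \<Theta> a] by (simp add: meas_ker_def)
    from pre_annihilatorD(2)[OF f this] show ?thesis
      by (simp add: ell1_to_meas_apply[OF PC[OF f]])
  qed
  \<comment> \<open>Restriction to the integers is isometric, so \<phi> is dominated on the
    pre-annihilator and extends without increasing its norm. The norm control is needed for the
    lower bound on \<open>iota\<close>.\<close>
  have ext: "\<exists>\<Psi>\<in>meas S. (\<forall>f\<in>?P. \<Psi> f = \<phi> (f \<circ> j)) \<and> meas_norm S \<Psi> \<le> dual_norm UNIV ?F \<phi>"
    if \<phi>: "\<phi> \<in> dual_space UNIV ?F" for \<phi>
  proof -
    let ?K = "dual_norm UNIV ?F \<phi>"
    have bF: "bounded (range x)" if "x \<in> ?F" for x using that F(1) by (auto simp: ell_inf_def)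
    have K: "0 \<le> ?K" by (rule dual_norm_nonneg[OF \<phi> F(2) _ bF]) simp
    let ?G = "{(f, \<phi> (f \<circ> j)) | f. f \<in> ?P}"
    obtain \<Psi> where \<Psi>: "\<Psi> \<in> dual_space ?A ?V" "\<And>f. f \<in> ?V \<Longrightarrow> norm (\<Psi> f) \<le> ?K * sup_norm ?A f"
      "\<And>f a. (f, a) \<in> ?G \<Longrightarrow> \<Psi> f = a"
    proof (rule hahn_banach_dual_space[OF V D(4) bdd K, of ?G])
      show "?G \<noteq> {}" using complex_subspaceD(1)[OF P] by blast
      show "Domain ?G \<subseteq> ?V" using PC by blast
    next
      fix f a g b c assume "(f, a) \<in> ?G" "(g, b) \<in> ?G"
      then have fg: "f \<in> ?P" "a = \<phi> (f \<circ> j)" "g \<in> ?P" "b = \<phi> (g \<circ> j)" by blast+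
      have "a + c * b = \<phi> ((\<lambda>i. f i + c * g i) \<circ> j)"
        using dual_space_comb(1)[OF \<phi> F(2) PF[OF fg(1)] PF[OF fg(3)], of c] fg(2,4) by (simp add: o_def)
      then show "(\<lambda>i. f i + c * g i, a + c * b) \<in> ?G"
        using complex_subspaceD(4)[OF P fg(1,3)] by blast
    next
      fix f a assume "(f, a) \<in> ?G"
      then have f: "f \<in> ?P" "a = \<phi> (f \<circ> j)" by blast+
      have "norm (\<phi> (f \<circ> j)) \<le> ?K * sup_norm UNIV (f \<circ> j)"
        by (rule dual_norm_upper[OF \<phi> F(2) _ bF PF[OF f(1)]]) simp
      then show "norm a \<le> ?K * sup_norm ?A f" by (simp add: f(2) sup_norm_comp[OF S PC[OF f(1)]])
    qed (assumption, rule that)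
    have "meas_norm S \<Psi> \<le> ?K"
      unfolding meas_norm_def by (rule dual_norm_least[OF V D(4) K \<Psi>(2)])
    then show ?thesis using \<Psi>(1,3) unfolding meas_def by blast
  qed
  have inj: "inj_on (iota ?F) ell1"
  proof (rule inj_onI)
    fix a b assume a: "a \<in> ell1" and b: "b \<in> ell1" and eq: "iota ?F a = iota ?F b"
    let ?d = "\<lambda>n. a n + - 1 * b n"
    have d: "?d \<in> ell1" by (rule complex_subspaceD(4)[OF complex_subspace_ell1 a b])
    have "ell1_to_meas S j ?d f = 0" if f: "f \<in> ?P" for f
    proof -
      have x: "f \<circ> j \<in> ell_inf" using PF[OF f] F(1) by blast
      have "pairing (f \<circ> j) a = pairing (f \<circ> j) b"
        using fun_cong[OF eq, of "f \<circ> j"] PF[OF f] by (simp add: iota_eq_pairing)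
      moreover have "pairing (f \<circ> j) ?d = pairing (f \<circ> j) a + - 1 * pairing (f \<circ> j) b"
        using pairing_add_right[OF x a complex_subspaceD(3)[OF complex_subspace_ell1 b], of "- 1"]
        by (simp only: pairing_scale_right)
      ultimately show ?thesis by (simp add: ell1_to_meas_apply[OF PC[OF f]])
    qed
    then have "ell1_to_meas S j ?d \<in> ?N" by (rule bipolar[OF ell1_to_meas_meas[OF S d]])
    then have "?d = (\<lambda>_. 0)" using bounded_projectionD(4)[OF \<Theta> d] by (simp add: meas_ker_def)
    then show "a = b" by (simp add: fun_eq_iff)
  qed
  have rep: "iota ?F (\<Theta> \<Psi>) = \<phi>"
    if \<phi>: "\<phi> \<in> dual_space UNIV ?F" and \<Psi>: "\<Psi> \<in> meas S" "\<forall>f\<in>?P. \<Psi> f = \<phi> (f \<circ> j)" for \<phi> \<Psi>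
  proof
    fix x show "iota ?F (\<Theta> \<Psi>) x = \<phi> x"
    proof (cases "x \<in> ?F")
      case True
      then obtain f where "f \<in> ?P" "x = f \<circ> j" by (auto simp: restrict_to_int_def)
      then show ?thesis using eval[OF \<Psi>(1)] \<Psi>(2) True by (simp add: iota_eq_pairing)
    next
      case False
      then show ?thesis using dual_spaceD(3)[OF \<phi>] by (simp add: iota_def)
    qed
  qed
  have "iota ?F ` ell1 = dual_space UNIV ?F"
  proof (intro equalityI subsetI)
    fix \<phi> assume "\<phi> \<in> iota ?F ` ell1"
    then show "\<phi> \<in> dual_space UNIV ?F" using iota_dual_space[OF F] by blast
  next
    fix \<phi> assume \<phi>: "\<phi> \<in> dual_space UNIV ?F"
    then obtain \<Psi> where \<Psi>: "\<Psi> \<in> meas S" "\<forall>f\<in>?P. \<Psi> f = \<phi> (f \<circ> j)" using ext by blast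
    from rep[OF \<phi> this] bounded_projectionD(1)[OF \<Theta> \<Psi>(1)]
    show "\<phi> \<in> iota ?F ` ell1" by blast
  qed
  with inj have bij: "bij_betw (iota ?F) ell1 (dual_space UNIV ?F)" by (simp add: bij_betw_def)
  obtain K where K: "\<And>\<Phi>. \<Phi> \<in> meas S \<Longrightarrow> ell1_norm (\<Theta> \<Phi>) \<le> K * meas_norm S \<Phi>"
    using bounded_projectionD(5)[OF \<Theta>] by blast
  \<comment> \<open>Extend \<open>iota ?F a\<close> to a measure of no larger norm. Injectivity
    shows that \<Theta> maps this measure back to \<open>a\<close>, so the bound of \<Theta> bounds
    the inverse of \<open>iota\<close>.\<close>
  have "ell1_norm a \<le> \<bar>K\<bar> * dual_norm UNIV ?F (iota ?F a)" if a: "a \<in> ell1" for a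
  proof -
    have \<phi>: "iota ?F a \<in> dual_space UNIV ?F" by (rule iota_dual_space[OF F a])
    obtain \<Psi> where \<Psi>: "\<Psi> \<in> meas S" "\<forall>f\<in>?P. \<Psi> f = iota ?F a (f \<circ> j)"
      "meas_norm S \<Psi> \<le> dual_norm UNIV ?F (iota ?F a)"
      using ext[OF \<phi>] by blast
    have "\<Theta> \<Psi> = a"
      using inj_onD[OF inj rep[OF \<phi> \<Psi>(1,2)] bounded_projectionD(1)[OF \<Theta> \<Psi>(1)] a] .
    then have "ell1_norm a \<le> K * meas_norm S \<Psi>" using K[OF \<Psi>(1)] by simp
    also have "\<dots> \<le> \<bar>K\<bar> * dual_norm UNIV ?F (iota ?F a)"
      using \<Psi>(3) dual_norm_nonneg[OF \<Psi>(1)[unfolded meas_def] V D(4) bdd]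
      by (intro mult_mono) (auto simp: meas_norm_def)
    finally show ?thesis .
  qed
  moreover have "\<exists>K. \<forall>a\<in>ell1. dual_norm UNIV ?F (iota ?F a) \<le> K * ell1_norm a"
    using dual_norm_iota_le[OF F] by (intro exI[of _ 1]) simp
  ultimately have "concrete_predual ?F"
    using FC bij complex_linear_on_iota[OF F(1)] unfolding concrete_predual_def by blast
  then show ?thesis
    using shift_restrict_pre_annihilator[OF S hom] by (simp add: shift_invariant_predual_def)
qed

section \<open>The compactification defined by a predual\<close>

text \<open>The weak-star topology of the dual of \<open>E\<close>, carried over to
  \<open>ell1\<close>. The topology on functions is the product topology; coordinates off
  \<open>E\<close> are constantly 0, so this is convergence tested on \<open>E\<close>.\<close>

definition predual_topology :: "(int \<Rightarrow> complex) set \<Rightarrow> (int \<Rightarrow> complex) topology" where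
  "predual_topology E = pullback_topology ell1 (iota E) euclidean"

definition predual_compactification :: "(int \<Rightarrow> complex) set \<Rightarrow> (int \<Rightarrow> complex) topology" where
  "predual_compactification E =
     subtopology (predual_topology E) (predual_topology E closure_of range unit_vec)"

text \<open>The adjoint of the embedding of \<open>E\<close> into the continuous functions on the compactification;
  it sends a measure to its barycentre in $\ell_1(Z) = E^*$.\<close>

definition predual_projection ::
  "(int \<Rightarrow> complex) set \<Rightarrow> (((int \<Rightarrow> complex) \<Rightarrow> complex) \<Rightarrow> complex) \<Rightarrow> (int \<Rightarrow> complex)" where
  "predual_projection E \<Phi> = inv_into ell1 (iota E) (\<lambda>x. if x \<in> E then \<Phi> (pairing x) else 0)"

lemma shift_invariant_predualD:
  assumes "shift_invariant_predual E"
  shows "closed_subspace_ell_inf E" "E \<subseteq> ell_inf" "complex_subspace E" "shift ` E = E"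
    and "inj_on (iota E) ell1" "iota E ` ell1 = dual_space UNIV E"
    and "\<exists>K. \<forall>a\<in>ell1. ell1_norm a \<le> K * dual_norm UNIV E (iota E a)"
    and "t \<in> ell1 \<Longrightarrow> x \<in> E \<Longrightarrow> ell1_act t x \<in> E"
proof -
  have "concrete_predual E" and inv: "shift ` E = E" using assms by (auto simp: shift_invariant_predual_def)
  then have E: "closed_subspace_ell_inf E" by (simp add: concrete_predual_def)
  then show "closed_subspace_ell_inf E" "E \<subseteq> ell_inf" "complex_subspace E" "shift ` E = E"
    using closed_subspace_ell_infD[OF E] inv by auto
  show "t \<in> ell1 \<Longrightarrow> x \<in> E \<Longrightarrow> ell1_act t x \<in> E" using shift_invariant_act[OF E inv] by blast
  show "inj_on (iota E) ell1" "iota E ` ell1 = dual_space UNIV E"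
    "\<exists>K. \<forall>a\<in>ell1. ell1_norm a \<le> K * dual_norm UNIV E (iota E a)"
    using \<open>concrete_predual E\<close> by (auto simp: concrete_predual_def bij_betw_def)
qed

section \<open>The weak-star topology on \<open>ell1\<close> and the compactification inside
  it\<close>

lemma topspace_predual_topology: "topspace (predual_topology E) = ell1"
  by (simp add: predual_topology_def topspace_pullback_topology)

lemma continuous_map_pairing:
  assumes "x \<in> E"
  shows "continuous_map (predual_topology E) euclidean (pairing x)"
proof -
  have "continuous_map euclidean euclidean (\<lambda>\<phi> :: (int \<Rightarrow> complex) \<Rightarrow> complex. \<phi> x)"
    unfolding continuous_map_iff_continuous2 by (rule continuous_on_product_coordinates)
  from continuous_map_pullback[OF this, of ell1 "iota E"] show ?thesis
    using assms by (simp add: predual_topology_def o_def iota_eq_pairing eta_contract_eq)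
qed

lemma continuous_map_into_predual_topology:
  assumes g: "\<And>p. p \<in> topspace X \<Longrightarrow> g p \<in> ell1"
    and cont: "\<And>x. x \<in> E \<Longrightarrow> continuous_map X euclidean (\<lambda>p. pairing x (g p))"
  shows "continuous_map X (predual_topology E) g"
  unfolding predual_topology_def
proof (rule continuous_map_pullback')
  have "continuous_map X euclidean (\<lambda>p. iota E (g p) x)" for x
  proof (cases "x \<in> E")
    case True
    then show ?thesis using cont by (simp add: iota_eq_pairing)
  next
    case False
    then show ?thesis by (simp add: iota_def)
  qed
  then have "continuous_map X (product_topology (\<lambda>_. euclidean) UNIV) (iota E \<circ> g)"
    by (simp add: continuous_map_componentwise_UNIV)
  then show "continuous_map X euclidean (iota E \<circ> g)" by (simp add: euclidean_product_topology)
qed (use g in auto)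

lemma Hausdorff_predual_topology:
  assumes "inj_on (iota E) ell1"
  shows "Hausdorff_space (predual_topology E)"
proof (rule Hausdorff_space_injective_preimage)
  have "Hausdorff_space (product_topology (\<lambda>_ :: int \<Rightarrow> complex. euclidean :: complex topology) UNIV)"
    by (simp add: Hausdorff_space_product_topology)
  then show "Hausdorff_space (euclidean :: ((int \<Rightarrow> complex) \<Rightarrow> complex) topology)"
    by (simp add: euclidean_product_topology)
  show "continuous_map (predual_topology E) euclidean (iota E)"
    using continuous_map_pullback[OF continuous_map_id, of ell1 "iota E" euclidean]
    by (simp add: predual_topology_def)
  show "inj_on (iota E) (topspace (predual_topology E))"
    using assms by (simp add: topspace_predual_topology)
qed

text \<open>Banach-Alaoglu: the functionals of norm at most 1 on \<open>E\<close> form a closed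
  subset \<open>B\<close> of a product of discs. Its preimage in \<open>ell1\<close> is compact and
  contains all unit vectors, hence their closure.\<close>

lemma compactin_predual_closure:
  assumes E: "shift_invariant_predual E"
  shows "compactin (predual_topology E) (predual_topology E closure_of range unit_vec)"
proof -
  note D = shift_invariant_predualD[OF E]
  note V = complex_subspaceD[OF D(3)]
  let ?W = "predual_topology E"
  \<comment> \<open>Radius 0 off \<open>E\<close> forces the vanishing there that
    \<open>dual_space\<close> demands.\<close>
  define r where "r x = (if x \<in> E then sup_norm UNIV x else 0)" for x
  define B where "B = {\<phi> :: (int \<Rightarrow> complex) \<Rightarrow> complex.
    (\<forall>x. norm (\<phi> x) \<le> r x) \<and>
    (\<forall>x\<in>E. \<forall>y\<in>E. \<phi> (\<lambda>i. x i + y i) = \<phi> x + \<phi> y) \<and>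
    (\<forall>c. \<forall>x\<in>E. \<phi> (\<lambda>i. c * x i) = c * \<phi> x)}"
  have B_dual: "B \<subseteq> iota E ` ell1"
  proof
    fix \<phi> assume \<phi>: "\<phi> \<in> B"
    have r: "norm (\<phi> x) \<le> r x" for x using \<phi> by (simp add: B_def)
    have "\<phi> \<in> dual_space UNIV E"
    proof (rule dual_spaceI[where K = 1])
      show "norm (\<phi> x) \<le> 1 * sup_norm UNIV x" if "x \<in> E" for x
        using r[of x] that by (simp add: r_def)
      show "\<phi> x = 0" if "x \<notin> E" for x
        using r[of x] that by (simp add: r_def)
    qed (use \<phi> in \<open>simp_all add: B_def\<close>)
    then show "\<phi> \<in> iota E ` ell1" using D(6) by simp
  qed
  have "compact (PiE UNIV (\<lambda>x. cball 0 (r x) :: complex set))"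
  proof -
    have "compactin (product_topology (\<lambda>_. euclidean) UNIV) (PiE UNIV (\<lambda>x. cball 0 (r x) :: complex set))"
      by (simp add: compactin_PiE)
    then show ?thesis by (simp add: euclidean_product_topology)
  qed
  moreover have "closed B"
    unfolding B_def Ball_def
    by (intro closed_Collect_conj closed_Collect_all closed_Collect_imp closed_Collect_eq closed_Collect_le
        open_Collect_const continuous_intros continuous_on_product_coordinates)
  moreover have "B \<subseteq> PiE UNIV (\<lambda>x. cball 0 (r x))" by (auto simp: B_def)
  ultimately have "compact B" using compact_Int_closed by (metis inf.absorb_iff2)
  let ?g = "inv_into ell1 (iota E)"
  have g: "?g \<phi> \<in> ell1" "iota E (?g \<phi>) = \<phi>" if "\<phi> \<in> B" for \<phi>
    using inv_into_into f_inv_into_f that B_dual by (metis subsetD)+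
  \<comment> \<open>The topology of \<open>?W\<close> is tested by pairings with \<open>E\<close>,
    and composed with the inverse of \<open>iota E\<close> these are coordinate evaluations.\<close>
  have "continuous_map (top_of_set B) ?W ?g"
  proof (rule continuous_map_into_predual_topology)
    fix x assume x: "x \<in> E"
    have "continuous_map (top_of_set B) euclidean (\<lambda>\<phi>. \<phi> x)"
      unfolding continuous_map_iff_continuous
      by (rule continuous_on_subset[OF continuous_on_product_coordinates subset_UNIV])
    moreover have "\<phi> x = pairing x (?g \<phi>)" if "\<phi> \<in> B" for \<phi>
      using fun_cong[OF g(2)[OF that], of x] iota_eq_pairing[OF x] by simp
    ultimately show "continuous_map (top_of_set B) euclidean (\<lambda>\<phi>. pairing x (?g \<phi>))"
      by (rule continuous_map_eq) simp
  qed (use g in simp)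
  then have comp: "compactin ?W (?g ` B)"
    using image_compactin[of "top_of_set B" B ?W ?g] \<open>compact B\<close>
    by (simp add: compactin_subtopology)
  have "range unit_vec \<subseteq> ?g ` B"
  proof
    fix s assume "s \<in> range unit_vec"
    then obtain m where s: "s = unit_vec m" by blast
    have "iota E s = (\<lambda>x. if x \<in> E then x m else 0)"
      by (simp add: s iota_eq pairing_unit_vec cong: if_cong)
    moreover have "norm (x m) \<le> sup_norm UNIV x" if "x \<in> E" for x
      using norm_le_sup_norm D(2) that by blast
    ultimately have "iota E s \<in> B" using V(2,3) by (simp add: B_def r_def)
    moreover have "?g (iota E s) = s" using inv_into_f_f[OF D(5)] unit_vec_ell1 s by simp
    ultimately show "s \<in> ?g ` B" by force
  qed
  then have "?W closure_of range unit_vec \<subseteq> ?g ` B"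
    using closure_of_minimal compactin_imp_closedin[OF Hausdorff_predual_topology[OF D(5)] comp] by blast
  then show ?thesis by (rule closed_compactin[OF comp _ closedin_closure_of])
qed

lemma topspace_predual_compactification:
  "topspace (predual_compactification E) = predual_topology E closure_of range unit_vec"
  by (simp add: predual_compactification_def closure_of_subset_topspace inf.absorb2)

lemma predual_compactification_ell1: "s \<in> topspace (predual_compactification E) \<Longrightarrow> s \<in> ell1"
  using closure_of_subset_topspace[of "predual_topology E" "range unit_vec"]
  by (auto simp: topspace_predual_compactification topspace_predual_topology)

lemma pairing_cont_funs: "x \<in> E \<Longrightarrow> pairing x \<in> cont_funs (predual_compactification E)"
  by (simp add: cont_funs_def predual_compactification_def continuous_map_from_subtopology continuous_map_pairing)

lemma semigroup_compactification_predual: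
  assumes E: "shift_invariant_predual E"
  shows "semigroup_compactification (predual_compactification E) ell1_conv unit_vec"
proof -
  note D = shift_invariant_predualD[OF E]
  let ?W = "predual_topology E" and ?S = "predual_compactification E"
  let ?C = "predual_topology E closure_of range unit_vec"
  note top = topspace_predual_compactification[of E]
  note C_ell1 = predual_compactification_ell1[of _ E, unfolded top]
  \<comment> \<open>Pairing the product with \<open>x\<close> is pairing \<open>s\<close> with
    \<open>ell1_act t x\<close>, which is again a member of \<open>E\<close>; this is where shift
    invariance gives separate continuity.\<close>
  have contW: "continuous_map ?W ?W (\<lambda>s. ell1_conv s t)" if t: "t \<in> ell1" for t
  proof (rule continuous_map_into_predual_topology)
    show "ell1_conv s t \<in> ell1" if "s \<in> topspace ?W" for s
      using that t by (simp add: topspace_predual_topology ell1_conv_ell1)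
    fix x assume x: "x \<in> E"
    show "continuous_map ?W euclidean (\<lambda>s. pairing x (ell1_conv s t))"
    proof (rule continuous_map_eq)
      show "continuous_map ?W euclidean (pairing (ell1_act t x))"
        by (rule continuous_map_pairing[OF D(8)[OF t x]])
      show "pairing (ell1_act t x) s = pairing x (ell1_conv s t)" if "s \<in> topspace ?W" for s
        using that x t D(2) by (auto simp: pairing_conv topspace_predual_topology)
    qed
  qed
  have unit_C: "range unit_vec \<subseteq> ?C"
    by (rule closure_of_subset) (auto simp: topspace_predual_topology unit_vec_ell1)
  have conv_unit: "ell1_conv s (unit_vec m) \<in> ?C" if s: "s \<in> ?C" for s m
  proof -
    have "(\<lambda>s. ell1_conv s (unit_vec m)) ` ?C \<subseteq> ?W closure_of ((\<lambda>s. ell1_conv s (unit_vec m)) ` range unit_vec)"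
      by (rule continuous_map_image_closure_subset[OF contW[OF unit_vec_ell1]])
    also have "\<dots> \<subseteq> ?C"
      by (rule closure_of_mono) (auto simp: ell1_conv_unit_vecs)
    finally show ?thesis using s by blast
  qed
  \<comment> \<open>With separate continuity only, the closure is taken in one variable at a time:
    \<open>conv_unit\<close> handles a unit vector as one factor, and here that factor runs through
    the closure.\<close>
  have conv_C: "ell1_conv t s \<in> ?C" if s: "s \<in> ?C" and t: "t \<in> ?C" for s t
  proof -
    have "(\<lambda>u. ell1_conv u s) ` ?C \<subseteq> ?W closure_of ((\<lambda>u. ell1_conv u s) ` range unit_vec)"
      by (rule continuous_map_image_closure_subset[OF contW[OF C_ell1[OF s]]])
    also have "\<dots> \<subseteq> ?C"
      using conv_unit[OF s] by (intro closure_of_minimal) (auto simp: ell1_conv_commute[of _ s])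
    finally show ?thesis using t by blast
  qed
  have contS: "continuous_map ?S ?S (\<lambda>s. ell1_conv s t)" if t: "t \<in> ?C" for t
    unfolding predual_compactification_def continuous_map_in_subtopology
    using conv_C[OF t] contW[OF C_ell1[OF t]]
    by (auto intro: continuous_map_from_subtopology)
  have contS': "continuous_map ?S ?S (\<lambda>s. ell1_conv t s)" if "t \<in> ?C" for t
    using contS[OF that] by (subst ell1_conv_commute)
  have "inj unit_vec"
    by (rule injI) (metis unit_vec_def zero_neq_one)
  moreover have "?S closure_of range unit_vec = ?C"
    using unit_C by (simp add: predual_compactification_def closure_of_subtopology inf.absorb2)
  moreover have "compact_space ?S"
    unfolding predual_compactification_def by (rule compact_space_subtopology[OF compactin_predual_closure[OF E]])
  moreover have "Hausdorff_space ?S"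
    unfolding predual_compactification_def
    by (rule Hausdorff_space_subtopology[OF Hausdorff_predual_topology[OF D(5)]])
  moreover have "semitopological_semigroup ?S ell1_conv"
    unfolding semitopological_semigroup_def top
    using conv_C contS contS' ell1_conv_assoc[OF C_ell1 C_ell1 C_ell1] by blast
  ultimately show ?thesis
    using unit_C unfolding semigroup_compactification_def top by (simp add: ell1_conv_unit_vecs)
qed

section \<open>Barycentres of measures and the projection\<close>

lemma predual_projection_unique:
  assumes E: "shift_invariant_predual E" and a: "a \<in> ell1"
    and eq: "\<And>x. x \<in> E \<Longrightarrow> \<Phi> (pairing x) = pairing x a"
  shows "predual_projection E \<Phi> = a"
proof -
  have "(\<lambda>x. if x \<in> E then \<Phi> (pairing x) else 0) = iota E a"
    using eq by (auto simp: fun_eq_iff iota_eq)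
  \<comment> \<open>The projection is an inverse image under \<open>iota E\<close>, so by
    injectivity identities for it only have to be tested on \<open>E\<close>.\<close>
  then show ?thesis
    unfolding predual_projection_def using inv_into_f_f[OF shift_invariant_predualD(5)[OF E] a] by simp
qed

lemma predual_projection:
  assumes E: "shift_invariant_predual E" and \<Phi>: "\<Phi> \<in> meas (predual_compactification E)"
  shows "predual_projection E \<Phi> \<in> ell1"
    and "x \<in> E \<Longrightarrow> pairing x (predual_projection E \<Phi>) = \<Phi> (pairing x)"
proof -
  note D = shift_invariant_predualD[OF E]
  let ?S = "predual_compactification E"
  note S = semigroup_compactification_predual[OF E]
  note \<Phi>' = \<Phi>[unfolded meas_def]
  note V = complex_subspace_cont_funs[of ?S]
  let ?\<phi> = "\<lambda>x. if x \<in> E then \<Phi> (pairing x) else 0"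
  obtain K where K: "\<And>f. f \<in> cont_funs ?S \<Longrightarrow> norm (\<Phi> f) \<le> K * sup_norm (topspace ?S) f"
    using dual_spaceD(4)[OF \<Phi>'] by blast
  have "?\<phi> \<in> dual_space UNIV E"
  proof (rule dual_spaceI[where K = K])
    fix x y assume x: "x \<in> E" and y: "y \<in> E"
    \<comment> \<open>Additivity of \<open>pairing\<close> in its first argument relies on
      summability, which is known on the carrier; scaling, by contrast, holds for all
      arguments.\<close>
    have "\<Phi> (pairing (\<lambda>i. x i + y i)) = \<Phi> (\<lambda>s. pairing x s + pairing y s)"
    proof (rule dual_space_cong[OF \<Phi>' V semigroup_compactificationD(4)[OF S]])
      show "pairing (\<lambda>i. x i + y i) \<in> cont_funs ?S"
        by (rule pairing_cont_funs[OF complex_subspaceD(2)[OF D(3) x y]])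
      show "(\<lambda>s. pairing x s + pairing y s) \<in> cont_funs ?S"
        by (rule complex_subspaceD(2)[OF V pairing_cont_funs[OF x] pairing_cont_funs[OF y]])
      show "pairing (\<lambda>i. x i + y i) s = pairing x s + pairing y s" if "s \<in> topspace ?S" for s
        using x y D(2) predual_compactification_ell1[OF that] by (auto intro: pairing_add_left)
    qed
    also have "\<dots> = \<Phi> (pairing x) + \<Phi> (pairing y)"
      by (rule dual_spaceD(1)[OF \<Phi>' pairing_cont_funs[OF x] pairing_cont_funs[OF y]])
    finally show "?\<phi> (\<lambda>i. x i + y i) = ?\<phi> x + ?\<phi> y"
      using x y complex_subspaceD(2)[OF D(3) x y] by simp
  next
    fix c x assume x: "x \<in> E"
    have "pairing (\<lambda>i. c * x i) = (\<lambda>s. c * pairing x s)" by (rule ext) (rule pairing_scale_left)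
    then show "?\<phi> (\<lambda>i. c * x i) = c * ?\<phi> x"
      using x complex_subspaceD(3)[OF D(3) x] dual_spaceD(2)[OF \<Phi>' pairing_cont_funs[OF x]] by simp
  next
    fix x assume x: "x \<in> E"
    \<comment> \<open>On the unit vectors \<open>pairing x\<close> takes the values of
      \<open>x\<close>, so \<open>E\<close> embeds isometrically into C(S).\<close>
    have "sup_norm (topspace ?S) (pairing x) = sup_norm UNIV x"
      using sup_norm_comp[OF S pairing_cont_funs[OF x]] by (simp add: o_def pairing_unit_vec)
    then show "norm (?\<phi> x) \<le> K * sup_norm UNIV x"
      using K[OF pairing_cont_funs[OF x]] x by simp
  qed simp
  then have im: "?\<phi> \<in> iota E ` ell1" using D(6) by simp
  show "predual_projection E \<Phi> \<in> ell1"
    unfolding predual_projection_def by (rule inv_into_into[OF im])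
  have "iota E (predual_projection E \<Phi>) = ?\<phi>"
    unfolding predual_projection_def by (rule f_inv_into_f[OF im])
  then show "pairing x (predual_projection E \<Phi>) = \<Phi> (pairing x)" if "x \<in> E"
    using that by (metis iota_eq_pairing)
qed

lemma bounded_projection_predual:
  assumes E: "shift_invariant_predual E"
  shows "bounded_projection (predual_compactification E) unit_vec (predual_projection E)"
proof -
  note D = shift_invariant_predualD[OF E]
  let ?S = "predual_compactification E" and ?\<Theta> = "predual_projection E"
  note S = semigroup_compactification_predual[OF E]
  note V = complex_subspace_cont_funs[of ?S]
  note bdd = bounded_cont_funs[OF semigroup_compactificationD(1)[OF S]]
  note ne = semigroup_compactificationD(4)[OF S]
  have "?\<Theta> (\<lambda>f. \<Phi> f + \<Psi> f) = (\<lambda>n. ?\<Theta> \<Phi> n + ?\<Theta> \<Psi> n)" if \<Phi>: "\<Phi> \<in> meas ?S" and \<Psi>: "\<Psi> \<in> meas ?S" for \<Phi> \<Psi>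
  proof (rule predual_projection_unique[OF E])
    note a = predual_projection(1)[OF E \<Phi>] predual_projection(1)[OF E \<Psi>]
    show "(\<lambda>n. ?\<Theta> \<Phi> n + ?\<Theta> \<Psi> n) \<in> ell1" by (rule complex_subspaceD(2)[OF complex_subspace_ell1 a])
    show "\<Phi> (pairing x) + \<Psi> (pairing x) = pairing x (\<lambda>n. ?\<Theta> \<Phi> n + ?\<Theta> \<Psi> n)" if x: "x \<in> E" for x
      using pairing_add_right[OF subsetD[OF D(2) x] a] predual_projection(2)[OF E \<Phi> x]
        predual_projection(2)[OF E \<Psi> x] by simp
  qed
  moreover have "?\<Theta> (\<lambda>f. c * \<Phi> f) = (\<lambda>n. c * ?\<Theta> \<Phi> n)" if \<Phi>: "\<Phi> \<in> meas ?S" for \<Phi> c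
  proof (rule predual_projection_unique[OF E])
    show "(\<lambda>n. c * ?\<Theta> \<Phi> n) \<in> ell1"
      by (rule complex_subspaceD(3)[OF complex_subspace_ell1 predual_projection(1)[OF E \<Phi>]])
    show "c * \<Phi> (pairing x) = pairing x (\<lambda>n. c * ?\<Theta> \<Phi> n)" if "x \<in> E" for x
      using predual_projection(2)[OF E \<Phi> that] by (simp add: pairing_scale_right)
  qed
  ultimately have "complex_linear_on (meas ?S) ?\<Theta>" by (simp add: complex_linear_on_def)
  moreover have "?\<Theta> ` meas ?S \<subseteq> ell1" using predual_projection(1)[OF E] by blast
  moreover have "?\<Theta> (ell1_to_meas ?S unit_vec a) = a" if a: "a \<in> ell1" for a
    by (rule predual_projection_unique[OF E a])
       (simp add: ell1_to_meas_apply pairing_cont_funs o_def pairing_unit_vec)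
  moreover have "\<exists>K. \<forall>\<Phi>\<in>meas ?S. ell1_norm (?\<Theta> \<Phi>) \<le> K * meas_norm ?S \<Phi>"
  proof -
    \<comment> \<open>The adjoint of the isometric embedding of \<open>E\<close> is a contraction
      into the dual of \<open>E\<close>; the constant of the inverse of \<open>iota E\<close>
      converts this into an \<open>ell1\<close> bound.\<close>
    obtain K where K: "\<And>a. a \<in> ell1 \<Longrightarrow> ell1_norm a \<le> K * dual_norm UNIV E (iota E a)"
      using D(7) by blast
    have "ell1_norm (?\<Theta> \<Phi>) \<le> \<bar>K\<bar> * meas_norm ?S \<Phi>" if \<Phi>: "\<Phi> \<in> meas ?S" for \<Phi>
    proof -
      note \<Phi>' = \<Phi>[unfolded meas_def]
      note a = predual_projection[OF E \<Phi>]
      have nn: "0 \<le> meas_norm ?S \<Phi>"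
        unfolding meas_norm_def by (rule dual_norm_nonneg[OF \<Phi>' V ne bdd])
      have "norm (iota E (?\<Theta> \<Phi>) x) \<le> meas_norm ?S \<Phi> * sup_norm UNIV x" if x: "x \<in> E" for x
      proof -
        have "sup_norm UNIV x = sup_norm (topspace ?S) (pairing x)"
          using sup_norm_comp[OF S pairing_cont_funs[OF x]] by (simp add: o_def pairing_unit_vec)
        moreover have "norm (\<Phi> (pairing x)) \<le> meas_norm ?S \<Phi> * sup_norm (topspace ?S) (pairing x)"
          unfolding meas_norm_def by (rule dual_norm_upper[OF \<Phi>' V ne bdd pairing_cont_funs[OF x]])
        ultimately show ?thesis using a(2)[OF x] by (simp add: iota_eq_pairing[OF x])
      qed
      then have "dual_norm UNIV E (iota E (?\<Theta> \<Phi>)) \<le> meas_norm ?S \<Phi>"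
        by (intro dual_norm_least[OF D(3) _ nn]) auto
      moreover have "0 \<le> dual_norm UNIV E (iota E (?\<Theta> \<Phi>))"
        using D(2) by (intro dual_norm_nonneg[OF iota_dual_space[OF D(2,3) a(1)] D(3)]) (auto simp: ell_inf_def)
      ultimately have "K * dual_norm UNIV E (iota E (?\<Theta> \<Phi>)) \<le> \<bar>K\<bar> * meas_norm ?S \<Phi>"
        by (intro mult_mono) auto
      then show ?thesis using K[OF a(1)] by simp
    qed
    then show ?thesis by blast
  qed
  ultimately show ?thesis by (simp add: bounded_projection_def)
qed

text \<open>For \<open>f\<close> in the image of the predual the inner integral is again in the image of the
  predual, because \<open>E\<close> is an \<open>ell1\<close>-module; this replaces Grothendieck's theorem.\<close>

lemma conv_homomorphism_predual:
  assumes E: "shift_invariant_predual E"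
  shows "conv_homomorphism (predual_compactification E) ell1_conv (predual_projection E)"
  unfolding conv_homomorphism_def
proof (intro ballI)
  note D = shift_invariant_predualD[OF E]
  let ?S = "predual_compactification E" and ?\<Theta> = "predual_projection E"
  note S = semigroup_compactification_predual[OF E]
  note ne = semigroup_compactificationD(4)[OF S]
  note V = complex_subspace_cont_funs[of ?S]
  fix \<Phi> \<Psi> assume \<Phi>: "\<Phi> \<in> meas ?S" and \<Psi>: "\<Psi> \<in> meas ?S"
  note a = predual_projection[OF E \<Phi>] and b = predual_projection[OF E \<Psi>]
  show "?\<Theta> (meas_conv ?S ell1_conv \<Phi> \<Psi>) = ell1_conv (?\<Theta> \<Phi>) (?\<Theta> \<Psi>)"
  proof (rule predual_projection_unique[OF E ell1_conv_ell1[OF a(1) b(1)]])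
    fix x assume x: "x \<in> E"
    have xb: "x \<in> ell_inf" using D(2) x by blast
    \<comment> \<open>For fixed \<open>t\<close> the integrand is the pairing with
      \<open>ell1_act t x\<close>, so \<Phi> can be replaced by its barycentre. Commutativity then
      exchanges the roles of \<open>t\<close> and the barycentre, giving a pairing in
      \<open>t\<close>.\<close>
    have inner: "pairing (ell1_act (?\<Theta> \<Phi>) x) t = \<Phi> (\<lambda>s. pairing x (ell1_conv s t))"
      if "t \<in> topspace ?S" for t
    proof -
      have t: "t \<in> ell1" by (rule predual_compactification_ell1[OF that])
      have tx: "ell1_act t x \<in> E" by (rule D(8)[OF t x])
      have eq: "pairing (ell1_act t x) s = pairing x (ell1_conv s t)" if "s \<in> topspace ?S" for s
        using pairing_conv[OF xb predual_compactification_ell1[OF that] t] by simp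
      have "\<Phi> (\<lambda>s. pairing x (ell1_conv s t)) = \<Phi> (pairing (ell1_act t x))"
        using eq cont_funs_cong[OF pairing_cont_funs[OF tx] eq]
        by (intro dual_space_cong[OF \<Phi>[unfolded meas_def] V ne]) (auto simp: pairing_cont_funs[OF tx])
      also have "\<dots> = pairing x (ell1_conv (?\<Theta> \<Phi>) t)"
        using a(2)[OF tx] pairing_conv[OF xb a(1) t] by simp
      also have "\<dots> = pairing (ell1_act (?\<Theta> \<Phi>) x) t"
        using pairing_conv[OF xb t a(1)] by (simp add: ell1_conv_commute[of t])
      finally show ?thesis by simp
    qed
    have ax: "ell1_act (?\<Theta> \<Phi>) x \<in> E" by (rule D(8)[OF a(1) x])
    have "meas_conv ?S ell1_conv \<Phi> \<Psi> (pairing x) = \<Psi> (\<lambda>t. \<Phi> (\<lambda>s. pairing x (ell1_conv s t)))"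
      by (simp add: meas_conv_def pairing_cont_funs[OF x])
    also have "\<dots> = \<Psi> (pairing (ell1_act (?\<Theta> \<Phi>) x))"
      using inner cont_funs_cong[OF pairing_cont_funs[OF ax] inner]
      by (intro dual_space_cong[OF \<Psi>[unfolded meas_def] V ne]) (auto simp: pairing_cont_funs[OF ax])
    also have "\<dots> = pairing x (ell1_conv (?\<Theta> \<Phi>) (?\<Theta> \<Psi>))"
      using b(2)[OF ax] pairing_conv[OF xb b(1) a(1)] by (simp add: ell1_conv_commute[of "?\<Theta> \<Psi>"])
    finally show "meas_conv ?S ell1_conv \<Phi> \<Psi> (pairing x) = pairing x (ell1_conv (?\<Theta> \<Phi>) (?\<Theta> \<Psi>))" .
  qed
qed

text \<open>Exhibits the kernel as the annihilator of the embedded \<open>E\<close>, the form on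
  which both weak-star closedness and the pre-annihilator computation rely.\<close>

lemma meas_ker_predual:
  assumes E: "shift_invariant_predual E"
  shows "meas_ker (predual_compactification E) (predual_projection E) =
    {\<Phi> \<in> meas (predual_compactification E). \<forall>x\<in>E. \<Phi> (pairing x) = 0}"
proof -
  have "(predual_projection E \<Phi> = (\<lambda>_. 0)) = (\<forall>x\<in>E. \<Phi> (pairing x) = 0)"
    if \<Phi>: "\<Phi> \<in> meas (predual_compactification E)" for \<Phi>
  proof
    have pairing0: "pairing x (\<lambda>_. 0) = 0" for x by (simp add: pairing_def)
    show "\<forall>x\<in>E. \<Phi> (pairing x) = 0" if "predual_projection E \<Phi> = (\<lambda>_. 0)"
      using predual_projection(2)[OF E \<Phi>] that pairing0 by metis
    show "predual_projection E \<Phi> = (\<lambda>_. 0)" if "\<forall>x\<in>E. \<Phi> (pairing x) = 0"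
      using that pairing0 complex_subspaceD(1)[OF complex_subspace_ell1]
      by (intro predual_projection_unique[OF E]) auto
  qed
  then show ?thesis by (auto simp: meas_ker_def)
qed

text \<open>The kernel is an intersection of zero sets of evaluations, so its complement is a union
  of sub-basic open sets.\<close>

lemma weak_star_closed_meas_ker_predual:
  assumes E: "shift_invariant_predual E"
  shows "weak_star_closed (predual_compactification E)
    (meas_ker (predual_compactification E) (predual_projection E))"
proof -
  let ?S = "predual_compactification E"
  let ?T = "weak_star_topology (topspace ?S) (cont_funs ?S)"
  have top: "topspace ?T = meas ?S"
    using complex_subspaceD(1)[OF complex_subspace_cont_funs[of ?S]]
    unfolding meas_def by (intro topspace_weak_star_topology) blast
  have "openin ?T {\<phi> \<in> meas ?S. \<phi> (pairing x) \<in> - {0}}" if "x \<in> E" for x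
    unfolding weak_star_topology_def meas_def
    using pairing_cont_funs[OF that] by (intro topology_generated_by_Basis) blast
  then have "openin ?T (\<Union>x\<in>E. {\<phi> \<in> meas ?S. \<phi> (pairing x) \<in> - {0}})"
    by (intro openin_Union) auto
  also have "(\<Union>x\<in>E. {\<phi> \<in> meas ?S. \<phi> (pairing x) \<in> - {0}}) =
      meas ?S - meas_ker ?S (predual_projection E)"
    unfolding meas_ker_predual[OF E] by blast
  finally show ?thesis
    unfolding weak_star_closed_def closedin_def top by (simp add: meas_ker_def)
qed

lemma restrict_pre_annihilator_predual:
  assumes E: "shift_invariant_predual E"
  shows "restrict_to_int unit_vec (pre_annihilator (predual_compactification E)
    (meas_ker (predual_compactification E) (predual_projection E))) = E"
proof (intro equalityI subsetI)
  let ?S = "predual_compactification E"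
  let ?P = "pre_annihilator ?S (meas_ker ?S (predual_projection E))"
  note D = shift_invariant_predualD[OF E]
  note VE = complex_subspaceD[OF D(3)]
  note S = semigroup_compactification_predual[OF E]
  note V = complex_subspace_cont_funs[of ?S]
  have restr: "pairing x \<circ> unit_vec = x" for x by (simp add: o_def pairing_unit_vec)
  show "x \<in> restrict_to_int unit_vec ?P" if x: "x \<in> E" for x
  proof -
    have "pairing x \<in> ?P"
      using x pairing_cont_funs[OF x] unfolding pre_annihilator_def meas_ker_predual[OF E] by blast
    then show ?thesis using restr[of x] unfolding restrict_to_int_def by (metis imageI)
  qed
  show "y \<in> E" if y: "y \<in> restrict_to_int unit_vec ?P" for y
  proof (rule ccontr)
    assume "y \<notin> E"
    obtain f where f: "f \<in> ?P" "y = f \<circ> unit_vec" using y by (auto simp: restrict_to_int_def)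
    have fC: "f \<in> cont_funs ?S" by (rule pre_annihilatorD(1)[OF f(1)])
    obtain d where d: "0 < d" "\<And>z. z \<in> E \<Longrightarrow> \<exists>n. d < norm (z n - y n)"
      using closed_subspace_ell_infD(3)[OF D(1), of y] \<open>y \<notin> E\<close> by (metis not_le)
    \<comment> \<open>The functional that is 0 on functions restricting to \<open>E\<close> and 1 at
      \<open>f\<close>. Its extension belongs to the kernel, contradicting the choice of
      \<open>f\<close> in the pre-annihilator.\<close>
    let ?G = "{(\<lambda>s. w s + c * f s, c) | w c. w \<in> cont_funs ?S \<and> w \<circ> unit_vec \<in> E}"
    have GI: "(\<lambda>s. w s + c * f s, c) \<in> ?G" if "w \<in> cont_funs ?S" "w \<circ> unit_vec \<in> E" for w c
      using that by blast
    obtain \<Psi> where \<Psi>: "\<Psi> \<in> dual_space (topspace ?S) (cont_funs ?S)"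
      "\<And>g a. (g, a) \<in> ?G \<Longrightarrow> \<Psi> g = a"
    \<comment> \<open>The norm bound \<open>1 / d\<close> is the reciprocal of a positive lower
      bound for the distance from \<open>y\<close> to \<open>E\<close>.\<close>
    proof (rule hahn_banach_dual_space[of "cont_funs ?S" "topspace ?S" "1 / d" ?G])
      show "complex_subspace (cont_funs ?S)" by (rule V)
      show "topspace ?S \<noteq> {}" by (rule semigroup_compactificationD(4)[OF S])
      show "bounded (g ` topspace ?S)" if "g \<in> cont_funs ?S" for g
        using bounded_cont_funs[OF semigroup_compactificationD(1)[OF S] that] .
      show "0 \<le> 1 / d" using d(1) by simp
      show "?G \<noteq> {}" using GI[OF complex_subspaceD(1)[OF V]] VE(1) by (auto simp: o_def)
      show "Domain ?G \<subseteq> cont_funs ?S" using complex_subspaceD(4)[OF V _ fC] by blast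
    next
      fix g1 a1 g2 a2 c assume "(g1, a1) \<in> ?G" "(g2, a2) \<in> ?G"
      then obtain w1 w2 where
        1: "w1 \<in> cont_funs ?S" "w1 \<circ> unit_vec \<in> E" "g1 = (\<lambda>s. w1 s + a1 * f s)" and
        2: "w2 \<in> cont_funs ?S" "w2 \<circ> unit_vec \<in> E" "g2 = (\<lambda>s. w2 s + a2 * f s)"
        by blast
      have "(\<lambda>s. (w1 s + c * w2 s) + (a1 + c * a2) * f s, a1 + c * a2) \<in> ?G"
      proof (rule GI)
        show "(\<lambda>s. w1 s + c * w2 s) \<in> cont_funs ?S" by (rule complex_subspaceD(4)[OF V 1(1) 2(1)])
        show "(\<lambda>s. w1 s + c * w2 s) \<circ> unit_vec \<in> E" using VE(4)[OF 1(2) 2(2)] by (simp add: o_def)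
      qed
      then show "(\<lambda>i. g1 i + c * g2 i, a1 + c * a2) \<in> ?G" by (simp add: 1(3) 2(3) algebra_simps)
    next
      fix g a assume "(g, a) \<in> ?G"
      then obtain w where w: "w \<in> cont_funs ?S" "w \<circ> unit_vec \<in> E" "g = (\<lambda>s. w s + a * f s)" by blast
      have gC: "g \<in> cont_funs ?S" unfolding w(3) by (rule complex_subspaceD(4)[OF V w(1) fC])
      note bdd = bounded_cont_funs[OF semigroup_compactificationD(1)[OF S] gC]
      show "norm a \<le> 1 / d * sup_norm (topspace ?S) g"
      proof (cases "a = 0")
        case True
        then show ?thesis
          using d(1) sup_norm_nonneg[OF semigroup_compactificationD(4)[OF S] bdd] by simp
      next
        case False
        \<comment> \<open>Dividing \<open>g\<close> by \<open>- a\<close> exhibits an element of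
          \<open>E\<close> minus \<open>y\<close>, which exceeds \<open>d\<close> in modulus at some
          integer.\<close>
        obtain n where n: "d < norm ((- 1 / a) * w (unit_vec n) - y n)"
          using d(2)[OF VE(3)[OF w(2), of "- 1 / a"]] by auto
        have "norm a * d \<le> norm a * norm ((- 1 / a) * w (unit_vec n) - y n)"
          using n by (intro mult_left_mono) auto
        also have "\<dots> = norm (- (a * ((- 1 / a) * w (unit_vec n) - y n)))"
          by (simp only: norm_mult norm_minus_cancel)
        also have "- (a * ((- 1 / a) * w (unit_vec n) - y n)) = g (unit_vec n)"
          using False by (simp add: w(3) f(2) algebra_simps)
        also have "norm (g (unit_vec n)) \<le> sup_norm (topspace ?S) g"
          by (rule sup_norm_upper[OF bdd semigroup_compactificationD(3)[OF S]])
        finally show ?thesis using d(1) by (simp add: field_simps)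
      qed
    qed (rule that)
    have "\<Psi> (pairing x) = 0" if "x \<in> E" for x
      using \<Psi>(2)[OF GI[OF pairing_cont_funs[OF that], of 0]] that by (simp add: restr)
    then have "\<Psi> \<in> meas_ker ?S (predual_projection E)"
      using \<Psi>(1) unfolding meas_ker_predual[OF E] meas_def by blast
    then have "\<Psi> f = 0" by (rule pre_annihilatorD(2)[OF f(1)])
    moreover have "\<Psi> f = 1"
      using \<Psi>(2)[OF GI[OF complex_subspaceD(1)[OF V], of 1]] VE(1) by (simp add: o_def)
    ultimately show False by simp
  qed
qed

text \<open>A point mass integrates each \<open>pairing x\<close> to its value at that point, so the
  point is its own barycentre; the injectivity in (2) follows at once.\<close>

lemma predual_projection_point_mass:
  assumes E: "shift_invariant_predual E" and s: "s \<in> topspace (predual_compactification E)"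
  shows "predual_projection E (point_mass (predual_compactification E) s) = s"
  by (rule predual_projection_unique[OF E predual_compactification_ell1[OF s]])
     (simp add: point_mass_def pairing_cont_funs)

theorem theorem4p1:
  shows
    "(\<forall>(S :: 's topology) add j \<Theta>.
        semigroup_compactification S add j \<and>
        bounded_projection S j \<Theta> \<and> conv_homomorphism S add \<Theta> \<and>
        weak_star_closed S (meas_ker S \<Theta>) \<longrightarrow>
        shift_invariant_predual (restrict_to_int j (pre_annihilator S (meas_ker S \<Theta>))))
     \<and>
     (\<forall>E. shift_invariant_predual E \<longrightarrow>
        (\<exists>(S :: (int \<Rightarrow> complex) topology) add j \<Theta>.
           semigroup_compactification S add j \<and>
           bounded_projection S j \<Theta> \<and> conv_homomorphism S add \<Theta> \<and>
           weak_star_closed S (meas_ker S \<Theta>) \<and>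
           E = restrict_to_int j (pre_annihilator S (meas_ker S \<Theta>)) \<and>
           inj_on (\<lambda>s. \<Theta> (point_mass S s)) (topspace S)))"
proof (intro conjI allI impI)
  fix S :: "'s topology" and add j \<Theta>
  assume "semigroup_compactification S add j \<and> bounded_projection S j \<Theta> \<and>
    conv_homomorphism S add \<Theta> \<and> weak_star_closed S (meas_ker S \<Theta>)"
  then show "shift_invariant_predual (restrict_to_int j (pre_annihilator S (meas_ker S \<Theta>)))"
    by (elim conjE) (rule shift_invariant_predual_pre_annihilator)
next
  fix E assume E: "shift_invariant_predual E"
  have "inj_on (\<lambda>s. predual_projection E (point_mass (predual_compactification E) s))
      (topspace (predual_compactification E))"
    by (rule inj_onI) (simp add: predual_projection_point_mass[OF E])
  then show "\<exists>(S :: (int \<Rightarrow> complex) topology) add j \<Theta>.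
      semigroup_compactification S add j \<and>
      bounded_projection S j \<Theta> \<and> conv_homomorphism S add \<Theta> \<and>
      weak_star_closed S (meas_ker S \<Theta>) \<and>
      E = restrict_to_int j (pre_annihilator S (meas_ker S \<Theta>)) \<and>
      inj_on (\<lambda>s. \<Theta> (point_mass S s)) (topspace S)"
    using semigroup_compactification_predual[OF E] bounded_projection_predual[OF E]
      conv_homomorphism_predual[OF E] weak_star_closed_meas_ker_predual[OF E]
      restrict_pre_annihilator_predual[OF E]
    by (intro exI[of _ "predual_compactification E"] exI[of _ ell1_conv] exI[of _ unit_vec]
        exI[of _ "predual_projection E"]) simp
qed

end
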